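(* Let $|\Psi\rangle\in\mathcal{B}^n$ and $|\Psi'\rangle\in\mathcal{B}^k$ be $M$-party stabilizer states with stabilizer groups $S\subset G^n$ and $S'\subset G^k$, where $n=\sum_{\alpha\in M}n_\alpha$, $k=\sum_{\alpha\in M}k_\alpha$ and $0\le k_\alpha\le n_\alpha$ for all $\alpha$. Then $|\Psi'\rangle$ is extractable from $|\Psi\rangle$ if and only if there exists a linear injective map $T:S'\to S$ such that (i) $\omega(T(f)_\alpha,T(g)_\alpha)=\omega(f_\alpha,g_\alpha)$ for all $f,g\in S'$ and $\alpha\in M$ (the left side computed in $G^{n_\alpha}$, the right side in $G^{k_\alpha}$); and (ii) $(T\cdot S')_{\hat\alpha}=T\cdot(S'_{\hat\alpha})$ for all $\alpha\in M$, where $(T\cdot S')_{\hat\alpha}$ is the co-local subspace of the subspace $T(S')\subseteq G^n$ and $S'_{\hat\alpha}$ is the co-local subspace of $S'\subseteq G^k$.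
   Context: Let $G=\{00,01,10,11\}\cong\mathbb{F}_2^2$ and $G^n\cong\mathbb{F}_2^{2n}$, with elements written $f=(a_1,b_1,\dots,a_n,b_n)$. Put $\sigma_{00}=I$, $\sigma_{10}=\sigma^x$, $\sigma_{01}=\sigma^z$, $\sigma_{11}=\sigma^y$ and $\sigma(f)=\sigma_{a_1b_1}\otimes\cdots\otimes\sigma_{a_nb_n}$, an operator on $\mathcal{B}^n=(\mathbb{C}^2)^{\otimes n}$. The symplectic form is $\omega(f,f')=\sum_{j=1}^n(a_jb_j'+b_ja_j')\bmod 2$. For a subspace $S\subseteq G^n$, $S^\perp=\{f\in G^n:\omega(f,g)=0\ \forall g\in S\}$; $S$ is self-dual if $S^\perp=S$. A stabilizer state with stabilizer group $S$ is, for a self-dual $S\subset G^n$ and a sign function $\epsilon:S\to\{\pm1\}$ for which the equations are consistent, the unique (up to global phase) unit vector $|\Psi\rangle$ with $\sigma(f)|\Psi\rangle=\epsilon(f)|\Psi\rangle$ for all $f\in S$. The Clifford group $\mathcal{C}(n)$ is the set of unitaries $U$ on $\mathcal{B}^n$ with $U\sigma(f)U^\dagger=\pm\sigma(u(f))$ for all $f$ for some map $u:G^n\to G^n$. Multipartite setting: $M$ is a finite set of parties, the qubits of a state on $\mathcal B^n$ are distributed so that party $\alpha$ holds $n_\alpha$ of them, $n=\sum_\alpha n_\alpha$. For $f\in G^n$, $f_\alpha\in G^{n_\alpha}$ is the restriction of $f$ to the qubits of party $\alpha$. For a subspace $S\subseteq G^n$, the co-local subspace is $S_{\hat\alpha}=\{g\in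 S:g_\alpha=0\}$ (equal to $S$ if $n_\alpha=0$). Two $M$-party stabilizer states are LCU-equivalent if one equals $\bigotimes_\alpha U_\alpha$ applied to the other (up to global phase), with $U_\alpha\in\mathcal{C}(n_\alpha)$ acting on party $\alpha$'s qubits. Extractability: $|\Psi'\rangle\in\mathcal B^k$ (party $\alpha$ holding $k_\alpha\le n_\alpha$ qubits) is extractable from $|\Psi\rangle\in\mathcal{B}^n$ if $|\Psi\rangle$ is LCU-equivalent to $|\Psi'\rangle\otimes|\Psi''\rangle$ for some $M$-party stabilizer state $|\Psi''\rangle$ in which party $\alpha$ holds $n_\alpha-k_\alpha$ qubits (party $\alpha$'s $n_\alpha$ qubits being split into the $k_\alpha$ qubits of $|\Psi'\rangle$ and the $n_\alpha-k_\alpha$ qubits of $|\Psi''\rangle$). *)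

theory Defs
  imports Complex_Main
begin

text \<open>Qubits are labelled by elements of a type; an n-qubit system is a finite set Q
of labels. An element of G^n is a function Q -> {0,1}^2 (value (a,b) at each qubit),
zero outside Q. Computational basis states are bit assignments vanishing outside Q;
a vector of B^n is a complex function on those; operators are given by their
matrix kernels on the computational basis.\<close>

type_synonym 'q pauli = "'q \<Rightarrow> bool \<times> bool"
type_synonym 'q bits = "'q \<Rightarrow> bool"
type_synonym 'q state = "'q bits \<Rightarrow> complex"
type_synonym 'q op = "'q bits \<Rightarrow> 'q bits \<Rightarrow> complex"

definition Gsp :: "'q set \<Rightarrow> 'q pauli set" where
  "Gsp Q = {f. \<forall>q. q \<notin> Q \<longrightarrow> f q = (False, False)}"

definition pzero :: "'q pauli" where
  "pzero = (\<lambda>q. (False, False))"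

definition padd :: "'q pauli \<Rightarrow> 'q pauli \<Rightarrow> 'q pauli" where
  "padd f g = (\<lambda>q. (fst (f q) \<noteq> fst (g q), snd (f q) \<noteq> snd (g q)))"

text \<open>Symplectic form omega(f,g) = sum_j (a_j b'_j + b_j a'_j) mod 2 over the qubits in Q
(True represents 1).\<close>
definition omega :: "'q set \<Rightarrow> 'q pauli \<Rightarrow> 'q pauli \<Rightarrow> bool" where
  "omega Q f g = odd (card {q \<in> Q. (fst (f q) \<and> snd (g q)) \<noteq> (snd (f q) \<and> fst (g q))})"

definition subspace2 :: "'q set \<Rightarrow> 'q pauli set \<Rightarrow> bool" where
  "subspace2 Q S \<longleftrightarrow> S \<subseteq> Gsp Q \<and> pzero \<in> S \<and> (\<forall>f\<in>S. \<forall>g\<in>S. padd f g \<in> S)"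

definition sperp :: "'q set \<Rightarrow> 'q pauli set \<Rightarrow> 'q pauli set" where
  "sperp Q S = {f \<in> Gsp Q. \<forall>g\<in>S. \<not> omega Q f g}"

definition self_dual :: "'q set \<Rightarrow> 'q pauli set \<Rightarrow> bool" where
  "self_dual Q S \<longleftrightarrow> subspace2 Q S \<and> sperp Q S = S"

definition pq :: "'q set \<Rightarrow> ('q \<Rightarrow> 'm) \<Rightarrow> 'm \<Rightarrow> 'q set" where
  "pq Q party \<alpha> = {q \<in> Q. party q = \<alpha>}"

definition colocal :: "'q set \<Rightarrow> ('q \<Rightarrow> 'm) \<Rightarrow> 'm \<Rightarrow> 'q pauli set \<Rightarrow> 'q pauli set" where
  "colocal Q party \<alpha> S = {g \<in> S. \<forall>q \<in> pq Q party \<alpha>. g q = (False, False)}"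

definition basis :: "'q set \<Rightarrow> 'q bits set" where
  "basis Q = {x. \<forall>q. q \<notin> Q \<longrightarrow> \<not> x q}"

definition restrict_bits :: "'q set \<Rightarrow> 'q bits \<Rightarrow> 'q bits" where
  "restrict_bits A x = (\<lambda>q. q \<in> A \<and> x q)"

text \<open>Single-qubit Pauli matrices: sigma_00 = I, sigma_10 = sigma^x, sigma_01 = sigma^z,
sigma_11 = sigma^y; entry <y|sigma_ab|x>.\<close>
definition sig1 :: "bool \<Rightarrow> bool \<Rightarrow> bool \<Rightarrow> bool \<Rightarrow> complex" where
  "sig1 a b y x =
     (if \<not> a \<and> \<not> b then (if y = x then 1 else 0)
      else if a \<and> \<not> b then (if y \<noteq> x then 1 else 0)
      else if \<not> a \<and> b then (if y = x then (if x then -1 else 1) else 0)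
      else (if y \<noteq> x then (if x then - \<i> else \<i>) else 0))"

definition pauli_op :: "'q set \<Rightarrow> 'q pauli \<Rightarrow> 'q op" where
  "pauli_op Q f y x = (\<Prod>q\<in>Q. sig1 (fst (f q)) (snd (f q)) (y q) (x q))"

definition apply_op :: "'q set \<Rightarrow> 'q op \<Rightarrow> 'q state \<Rightarrow> 'q state" where
  "apply_op Q K \<psi> y = (\<Sum>x\<in>basis Q. K y x * \<psi> x)"

definition mmul :: "'q set \<Rightarrow> 'q op \<Rightarrow> 'q op \<Rightarrow> 'q op" where
  "mmul Q K L y x = (\<Sum>z\<in>basis Q. K y z * L z x)"

definition adj :: "'q op \<Rightarrow> 'q op" where
  "adj K y x = cnj (K x y)"

definition id_op :: "'q op" where
  "id_op y x = (if y = x then 1 else 0)"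

definition op_eq :: "'q set \<Rightarrow> 'q op \<Rightarrow> 'q op \<Rightarrow> bool" where
  "op_eq Q K L \<longleftrightarrow> (\<forall>y\<in>basis Q. \<forall>x\<in>basis Q. K y x = L y x)"

definition st_eq :: "'q set \<Rightarrow> 'q state \<Rightarrow> 'q state \<Rightarrow> bool" where
  "st_eq Q \<phi> \<psi> \<longleftrightarrow> (\<forall>x\<in>basis Q. \<phi> x = \<psi> x)"

definition unitary_on :: "'q set \<Rightarrow> 'q op \<Rightarrow> bool" where
  "unitary_on Q U \<longleftrightarrow> op_eq Q (mmul Q U (adj U)) id_op \<and> op_eq Q (mmul Q (adj U) U) id_op"

definition clifford :: "'q set \<Rightarrow> 'q op \<Rightarrow> bool" where
  "clifford Q U \<longleftrightarrow> unitary_on Q U \<and>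
     (\<exists>u. \<forall>f\<in>Gsp Q. u f \<in> Gsp Q \<and> (\<exists>s::complex. (s = 1 \<or> s = -1) \<and>
        op_eq Q (mmul Q (mmul Q U (pauli_op Q f)) (adj U)) (\<lambda>y x. s * pauli_op Q (u f) y x)))"

definition stabilizer_state :: "'q set \<Rightarrow> 'q pauli set \<Rightarrow> 'q state \<Rightarrow> bool" where
  "stabilizer_state Q S \<psi> \<longleftrightarrow>
     self_dual Q S \<and> (\<forall>x. x \<notin> basis Q \<longrightarrow> \<psi> x = 0) \<and>
     (\<Sum>x\<in>basis Q. (cmod (\<psi> x))\<^sup>2) = 1 \<and>
     (\<exists>\<epsilon>. \<forall>f\<in>S. (\<epsilon> f = 1 \<or> \<epsilon> f = -1) \<and>
        st_eq Q (apply_op Q (pauli_op Q f) \<psi>) (\<lambda>x. \<epsilon> f * \<psi> x))"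

definition tensor_local :: "'m set \<Rightarrow> 'q set \<Rightarrow> ('q \<Rightarrow> 'm) \<Rightarrow> ('m \<Rightarrow> 'q op) \<Rightarrow> 'q op" where
  "tensor_local M Q party U y x =
     (\<Prod>\<alpha>\<in>M. U \<alpha> (restrict_bits (pq Q party \<alpha>) y) (restrict_bits (pq Q party \<alpha>) x))"

text \<open>Extractability of |Psi'> (qubits Q', party map party') from |Psi> (qubits Q,
party map party). The injection e places the qubits of |Psi'> among the qubits of the
same party in |Psi>; |Psi''> lives on the remaining qubits Q - e`Q'.\<close>
definition extractable ::
  "'m set \<Rightarrow> 'q set \<Rightarrow> ('q \<Rightarrow> 'm) \<Rightarrow> 'q state \<Rightarrow> 'p set \<Rightarrow> ('p \<Rightarrow> 'm) \<Rightarrow> 'p state \<Rightarrow> bool" where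
  "extractable M Q' party' \<psi>' Q party \<psi> \<longleftrightarrow>
     (\<exists>e :: 'q \<Rightarrow> 'p. inj_on e Q' \<and> e ` Q' \<subseteq> Q \<and> (\<forall>q\<in>Q'. party (e q) = party' q) \<and>
       (\<exists>S'' \<psi>''. stabilizer_state (Q - e ` Q') S'' \<psi>'' \<and>
         (\<exists>U c. (\<forall>\<alpha>\<in>M. clifford (pq Q party \<alpha>) (U \<alpha>)) \<and> cmod c = 1 \<and>
            st_eq Q \<psi>
              (\<lambda>y. c * apply_op Q (tensor_local M Q party U)
                 (\<lambda>x. \<psi>' (\<lambda>q. q \<in> Q' \<and> x (e q)) * \<psi>'' (restrict_bits (Q - e ` Q') x)) y))))"

end

theory Submission
  imports Defs "HOL-Library.FuncSet"
begin

text \<open>A Clifford unitary is determined, up to signs, by a symplectic isometry, so extractability by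
  local Cliffords turns into a statement about local isometries. Conjugating the stabilizers
  of \<open>\<Psi>' \<otimes> \<Psi>''\<close> that come from \<open>S'\<close> gives \<open>T\<close>. Conversely, condition (ii) says precisely that
  \<open>f\<^sub>\<alpha> \<mapsto> T(f)\<^sub>\<alpha>\<close> is a well-defined injection on the local projection of \<open>S'\<close>; by (i) it is
  isometric, so by Witt's theorem it extends to a product of transvections, each of which is
  implemented by a Clifford unitary. Undoing these unitaries on \<open>\<Psi>\<close>, and correcting signs by a Pauli
  operator, yields a state stabilized by \<open>S'\<close> with the signs of \<open>\<Psi>'\<close>. It factors through \<open>\<Psi>'\<close>,
  because averaging these stabilizers projects onto the line of \<open>\<Psi>'\<close>.\<close>

subsection \<open>The symplectic form\<close>

text \<open>Two Pauli operators commute exactly when \<omega> vanishes, so a unitary permuting them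
  up to sign preserves \<omega>. The return from isometries to unitaries is the hard half.
  Transvections are used because their gates are explicit: exp(-i(pi/4)\<sigma>(h)) leaves operators
  commuting with \<sigma>(h) alone and turns any other \<sigma>(f) into a sign times \<sigma>(f+h).
  The projection of S' to one party may be degenerate for \<omega>, so it need not split off as an
  orthogonal summand; the isometry is therefore extended one vector at a time. The vectors this
  requires come from one fact, proved by character sums: every additive function on a subspace is
  the pairing with some vector. The same fact repairs the signs. A sign function is not
  multiplicative: \<epsilon>(f)\<epsilon>(g) and \<epsilon>(f+g) differ by the phase of
  \<sigma>(f)\<sigma>(g). That phase is common to both sign functions, so their quotient is
  multiplicative. The stabilizer group of the leftover state is recovered by pulling S back along
  the local isometries and keeping the elements supported on the remaining qubits.\<close>

lemma padd_ac: "padd f g = padd g f" "padd (padd f g) h = padd f (padd g h)"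
  "padd f (padd g h) = padd g (padd f h)"
  by (auto simp: padd_def fun_eq_iff)

lemma padd_simps [simp]:
  "padd f f = pzero" "padd f pzero = f" "padd pzero f = f" "padd f (padd f g) = g"
  by (auto simp: padd_def pzero_def fun_eq_iff prod_eq_iff)

lemma padd_eq_pzero [simp]: "padd f g = pzero \<longleftrightarrow> f = g"
  by (auto simp: padd_def pzero_def fun_eq_iff prod_eq_iff)

lemma padd_cancel [simp]: "padd f g = padd f h \<longleftrightarrow> g = h"
  by (metis padd_simps(4))

lemma Gsp_padd [simp]: "f \<in> Gsp Q \<Longrightarrow> g \<in> Gsp Q \<Longrightarrow> padd f g \<in> Gsp Q"
  and Gsp_pzero [simp]: "pzero \<in> Gsp Q"
  by (auto simp: Gsp_def padd_def pzero_def)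

lemma subspace2D:
  assumes "subspace2 Q S"
  shows "S \<subseteq> Gsp Q" "pzero \<in> S" "\<And>f g. f \<in> S \<Longrightarrow> g \<in> S \<Longrightarrow> padd f g \<in> S"
  using assms by (auto simp: subspace2_def)

lemma subspace2_Gsp: "subspace2 Q (Gsp Q)"
  by (auto simp: subspace2_def)

text \<open>This is (-1)^\<omega>. As a product over qubits it turns additivity mod 2, and splitting
  over subsystems, into termwise facts about products.\<close>

definition omega_sign :: "'q set \<Rightarrow> 'q pauli \<Rightarrow> 'q pauli \<Rightarrow> complex" where
  "omega_sign Q f g =
     (\<Prod>q\<in>Q. if (fst (f q) \<and> snd (g q)) \<noteq> (snd (f q) \<and> fst (g q)) then -1 else 1)"

lemma omega_sign_eq: "finite Q \<Longrightarrow> omega_sign Q f g = (if omega Q f g then -1 else 1)"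
  unfolding omega_sign_def omega_def
  by (simp add: prod.If_cases Int_def power_minus_odd)

lemma omega_sign_add: "omega_sign Q (padd f g) h = omega_sign Q f h * omega_sign Q g h"
  unfolding omega_sign_def prod.distrib[symmetric] by (intro prod.cong) (auto simp: padd_def)

lemma omega_sym: "omega Q f g = omega Q g f"
  unfolding omega_def by (rule arg_cong[where f = "\<lambda>A. odd (card A)"]) auto

lemma omega_padd_left: "finite Q \<Longrightarrow> omega Q (padd f g) h \<longleftrightarrow> omega Q f h \<noteq> omega Q g h"
  using omega_sign_add[of Q f g h] by (auto simp: omega_sign_eq split: if_splits)

lemma omega_padd_right: "finite Q \<Longrightarrow> omega Q h (padd f g) \<longleftrightarrow> omega Q h f \<noteq> omega Q h g"
  by (metis omega_padd_left omega_sym)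

lemma omega_self [simp]: "\<not> omega Q f f"
  by (auto simp: omega_def conj_commute)

lemma omega_pzero [simp]: "\<not> omega Q pzero f" "\<not> omega Q f pzero"
  by (auto simp: omega_def pzero_def)

lemma omega_cong:
  assumes "\<And>q. q \<in> Q \<Longrightarrow> f q = f' q" "\<And>q. q \<in> Q \<Longrightarrow> g q = g' q"
  shows "omega Q f g = omega Q f' g'"
  unfolding omega_def by (rule arg_cong[where f = "\<lambda>A. odd (card A)"]) (use assms in auto)

section \<open>Nondegeneracy, character sums and additive functions as pairings\<close>

lemma omega_nondegenerate:
  assumes "f \<in> Gsp Q" "f \<noteq> pzero"
  obtains g where "g \<in> Gsp Q" "omega Q f g"
proof -
  obtain q where q: "f q \<noteq> (False, False)" using assms by (auto simp: pzero_def)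
  \<comment> \<open>A single-qubit Pauli at \<open>q\<close> that anticommutes with
    \<open>f q\<close>: Z if \<open>f q\<close> has an X component, and X otherwise.\<close>
  define g where "g = pzero(q := if fst (f q) then (False, True) else (True, False))"
  have "q \<in> Q" using assms q by (auto simp: Gsp_def)
  then have "{q' \<in> Q. (fst (f q') \<and> snd (g q')) \<noteq> (snd (f q') \<and> fst (g q'))} = {q}"
    using q by (cases "f q") (auto simp: g_def pzero_def)
  then have "omega Q f g" by (simp only: omega_def) simp
  moreover have "g \<in> Gsp Q" using \<open>q \<in> Q\<close> by (auto simp: g_def Gsp_def pzero_def)
  ultimately show ?thesis using that by blast
qed

text \<open>One distributive law for both \<open>basis\<close> and \<open>Gsp\<close>: a function
  with fixed default \<open>d\<close> outside \<open>Q\<close> is the same as an element of a finite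
  product.\<close>

lemma sum_prod_supported:
  fixes F :: "'q \<Rightarrow> 'v::finite \<Rightarrow> complex"
  assumes "finite Q"
  shows "(\<Sum>f | \<forall>q. q \<notin> Q \<longrightarrow> f q = d. \<Prod>q\<in>Q. F q (f q)) = (\<Prod>q\<in>Q. \<Sum>v\<in>UNIV. F q v)"
proof -
  have "(\<Sum>f | \<forall>q. q \<notin> Q \<longrightarrow> f q = d. \<Prod>q\<in>Q. F q (f q)) = (\<Sum>f\<in>PiE Q (\<lambda>_. UNIV). \<Prod>q\<in>Q. F q (f q))"
    by (rule sum.reindex_bij_witness[where j = "\<lambda>f. restrict f Q" and i = "\<lambda>f q. if q \<in> Q then f q else d"])
      (auto simp: fun_eq_iff PiE_def extensional_def cong: prod.cong_simp)
  then show ?thesis using assms by (simp add: prod_sum_PiE)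
qed

lemma finite_supported:
  assumes "finite Q"
  shows "finite {f :: 'q \<Rightarrow> 'v::finite. \<forall>q. q \<notin> Q \<longrightarrow> f q = d}"
proof (rule finite_surj)
  show "finite (PiE Q (\<lambda>_. UNIV :: 'v set))" using assms by (simp add: finite_PiE)
  show "{f. \<forall>q. q \<notin> Q \<longrightarrow> f q = d} \<subseteq> (\<lambda>f q. if q \<in> Q then f q else d) ` PiE Q (\<lambda>_. UNIV)"
  proof
    fix f assume "f \<in> {f :: 'q \<Rightarrow> 'v. \<forall>q. q \<notin> Q \<longrightarrow> f q = d}"
    then show "f \<in> (\<lambda>f q. if q \<in> Q then f q else d) ` PiE Q (\<lambda>_. UNIV)"
      by (intro image_eqI[where x = "restrict f Q"]) auto
  qed
qed

lemma finite_Gsp [simp]: "finite Q \<Longrightarrow> finite (Gsp Q)"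
  unfolding Gsp_def by (rule finite_supported)

lemma finite_basis [simp]: "finite Q \<Longrightarrow> finite (basis Q)"
  using finite_supported[of Q False] by (simp add: basis_def)

lemma sum_prod_basis:
  "finite Q \<Longrightarrow> (\<Sum>x\<in>basis Q. \<Prod>q\<in>Q. F q (x q)) = (\<Prod>q\<in>Q. F q False + F q True :: complex)"
  using sum_prod_supported[of Q F False] by (simp add: basis_def UNIV_bool)

lemma sum_prod_Gsp:
  "finite Q \<Longrightarrow> (\<Sum>f\<in>Gsp Q. \<Prod>q\<in>Q. F q (f q)) = (\<Prod>q\<in>Q. \<Sum>p\<in>UNIV. F q p :: complex)"
  unfolding Gsp_def by (rule sum_prod_supported)

text \<open>Translation by \<open>w\<close> permutes \<open>W\<close> and flips every sign, so the
  sum equals its own negative.\<close>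

lemma character_sum:
  fixes \<chi> :: "'q pauli \<Rightarrow> bool"
  assumes W: "subspace2 Q W" and fin: "finite W"
    and add: "\<And>v w. v \<in> W \<Longrightarrow> w \<in> W \<Longrightarrow> \<chi> (padd v w) \<longleftrightarrow> \<chi> v \<noteq> \<chi> w"
    and w: "w \<in> W" "\<chi> w"
  shows "(\<Sum>v\<in>W. if \<chi> v then -1 else 1 :: complex) = 0" (is "?s = 0")
proof -
  have "?s = (\<Sum>v\<in>W. - (if \<chi> v then -1 else 1))"
    by (rule sum.reindex_bij_witness[where i = "padd w" and j = "padd w"])
      (use w add subspace2D(3)[OF W] in auto)
  then have "?s = - ?s" by (simp only: sum_negf)
  then show ?thesis by simp
qed

text \<open>Averaging the indicator functions of the solution sets over all \<open>z\<close> by characters gives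
  \<open>|G| / |W| \<noteq> 0\<close> solutions.\<close>

lemma functional_representable:
  assumes Q: "finite Q" and W: "subspace2 Q W"
    and add: "\<And>v w. v \<in> W \<Longrightarrow> w \<in> W \<Longrightarrow> l (padd v w) \<longleftrightarrow> l v \<noteq> l w"
  obtains z where "z \<in> Gsp Q" "\<And>v. v \<in> W \<Longrightarrow> omega Q z v = l v"
proof -
  have "\<exists>z\<in>Gsp Q. \<forall>v\<in>W. omega Q z v = l v"
  proof (rule ccontr)
    assume neg: "\<not> (\<exists>z\<in>Gsp Q. \<forall>v\<in>W. omega Q z v = l v)"
    define F :: "'a pauli \<Rightarrow> 'a pauli \<Rightarrow> complex"
      where "F z v = (if omega Q z v then -1 else 1) * (if l v then -1 else 1)" for z v
    have finW: "finite W" using subspace2D(1)[OF W] Q finite_subset finite_Gsp by blast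
    have "(\<Sum>v\<in>W. F z v) = 0" if z: "z \<in> Gsp Q" for z
    proof -
      obtain w where "w \<in> W" "omega Q z w \<noteq> l w" using neg z by blast
      then have "(\<Sum>v\<in>W. if omega Q z v \<noteq> l v then -1 else 1 :: complex) = 0"
        using Q by (intro character_sum[OF W finW, of _ w]) (auto simp: omega_padd_right add)
      moreover have "F z v = (if omega Q z v \<noteq> l v then -1 else 1)" for v by (simp add: F_def)
      ultimately show ?thesis by simp
    qed
    moreover have "(\<Sum>z\<in>Gsp Q. F z v) = 0" if v: "v \<in> W - {pzero}" for v
    proof -
      obtain w where "w \<in> Gsp Q" "omega Q v w"
        using v subspace2D(1)[OF W] omega_nondegenerate[of v Q] by auto
      then have "(\<Sum>z\<in>Gsp Q. if omega Q z v then -1 else 1 :: complex) = 0"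
        using Q by (intro character_sum[OF subspace2_Gsp, of _ _ w])
          (auto simp: omega_padd_left omega_sym[of Q w v])
      then show ?thesis unfolding F_def sum_distrib_right[symmetric] by simp
    qed
    \<comment> \<open>Double counting: every row sum of \<open>F\<close> vanishes by
      \<open>neg\<close>, every column sum except that of \<open>pzero\<close> by nondegeneracy.
      Hence the \<open>pzero\<close> column would vanish too, although all its entries are
      1.\<close>
    ultimately have "(\<Sum>z\<in>Gsp Q. F z pzero) = 0"
      using sum.swap[of F W "Gsp Q"] sum.remove[OF finW subspace2D(2)[OF W], of "\<lambda>v. \<Sum>z\<in>Gsp Q. F z v"]
      by simp
    moreover have "\<not> l pzero" using add[of pzero pzero] subspace2D(2)[OF W] by simp
    then have "F z pzero = 1" for z by (simp add: F_def)
    ultimately show False using Q Gsp_pzero[of Q] by auto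
  qed
  then show ?thesis using that by blast
qed

subsection \<open>Isometries and transvections\<close>

text \<open>Additivity and bijectivity on \<open>Gsp Q\<close> are consequences, derived below. This
  suits Clifford unitaries, whose map \<open>u\<close> is given as a bare function.\<close>

definition isometry :: "'q set \<Rightarrow> ('q pauli \<Rightarrow> 'q pauli) \<Rightarrow> bool" where
  "isometry Q u \<longleftrightarrow> u \<in> Gsp Q \<rightarrow> Gsp Q \<and>
     (\<forall>f\<in>Gsp Q. \<forall>g\<in>Gsp Q. omega Q (u f) (u g) = omega Q f g)"

lemma isometryD:
  assumes "isometry Q u" "f \<in> Gsp Q"
  shows "u f \<in> Gsp Q" "g \<in> Gsp Q \<Longrightarrow> omega Q (u f) (u g) = omega Q f g"
  using assms by (auto simp: isometry_def)

lemma Gsp_eqI: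
  assumes Q: "finite Q" and fg: "f \<in> Gsp Q" "g \<in> Gsp Q"
    and eq: "\<And>h. h \<in> Gsp Q \<Longrightarrow> omega Q f h = omega Q g h"
  shows "f = g"
proof (rule ccontr)
  assume "f \<noteq> g"
  then obtain h where "h \<in> Gsp Q" "omega Q (padd f g) h"
    using omega_nondegenerate[of "padd f g" Q] fg by auto
  then show False using eq Q by (auto simp: omega_padd_left)
qed

text \<open>A vector is determined by its pairings, and these survive \<open>u\<close>; hence
  injectivity. Finiteness gives surjectivity.\<close>

lemma isometry_bij:
  assumes Q: "finite Q" and u: "isometry Q u"
  shows "bij_betw u (Gsp Q) (Gsp Q)"
proof -
  have inj: "inj_on u (Gsp Q)"
  proof (rule inj_onI)
    fix f g assume fg: "f \<in> Gsp Q" "g \<in> Gsp Q" "u f = u g"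
    show "f = g" using Q fg(1,2)
      by (rule Gsp_eqI) (use isometryD(2)[OF u] fg in metis)
  qed
  moreover have "u ` Gsp Q = Gsp Q"
    using endo_inj_surj[OF finite_Gsp[OF Q] _ inj] isometryD(1)[OF u] by blast
  ultimately show ?thesis by (simp add: bij_betw_def)
qed

text \<open>By surjectivity it suffices to pair both sides with vectors \<open>u h'\<close>, where
  \<omega> can be pulled back to the arguments.\<close>

lemma isometry_padd:
  assumes Q: "finite Q" and u: "isometry Q u" and fg: "f \<in> Gsp Q" "g \<in> Gsp Q"
  shows "u (padd f g) = padd (u f) (u g)"
proof (rule Gsp_eqI[OF Q])
  fix h assume "h \<in> Gsp Q"
  then obtain h' where "h' \<in> Gsp Q" "h = u h'"
    using isometry_bij[OF Q u] by (auto simp: bij_betw_def)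
  then show "omega Q (u (padd f g)) h = omega Q (padd (u f) (u g)) h"
    using fg u Q by (simp add: isometryD omega_padd_left)
qed (use fg u in \<open>auto simp: isometryD\<close>)

lemma isometry_pzero:
  assumes "finite Q" "isometry Q u" shows "u pzero = pzero"
  using isometry_padd[OF assms, of pzero pzero] by simp

definition transvection :: "'q set \<Rightarrow> 'q pauli \<Rightarrow> 'q pauli \<Rightarrow> 'q pauli" where
  "transvection Q h f = (if omega Q f h then padd f h else f)"

text \<open>Transvections are involutions, so these products form a group. Recording the generation,
  beyond the isometry property, is what permits building a unitary by induction.\<close>

inductive_set transvections :: "'q set \<Rightarrow> ('q pauli \<Rightarrow> 'q pauli) set" for Q where
  id: "id \<in> transvections Q"
| step: "u \<in> transvections Q \<Longrightarrow> h \<in> Gsp Q \<Longrightarrow> transvection Q h \<circ> u \<in> transvections Q"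

text \<open>Expanding \<omega>(f + \<omega>(f,h)h, g + \<omega>(g,h)h), the two cross terms coincide
  and cancel mod 2, and \<omega>(h,h) = 0.\<close>

lemma transvections_isometry:
  assumes Q: "finite Q" and u: "u \<in> transvections Q"
  shows "isometry Q u"
  using u
proof induction
  case (step u h)
  then show ?case using Q
    by (auto simp: isometry_def transvection_def omega_padd_left omega_padd_right omega_sym[of Q h]
        Pi_iff)
qed (auto simp: isometry_def)

section \<open>Witt's extension theorem over the field with two elements\<close>

lemma subspace2_adjoin:
  assumes V: "subspace2 Q V" and a: "a \<in> Gsp Q"
  shows "subspace2 Q (V \<union> padd a ` V)"
proof -
  have "padd f g \<in> V \<union> padd a ` V" if "f \<in> V \<union> padd a ` V" "g \<in> V \<union> padd a ` V" for f g
    using that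
  proof (elim UnE imageE)
    fix x y assume "f = padd a x" "x \<in> V" "g = padd a y" "y \<in> V"
    moreover have "padd (padd a x) (padd a y) = padd x y"
      by (metis padd_ac padd_simps(4))
    ultimately show ?thesis using subspace2D(3)[OF V] by auto
  next
    fix x assume *: "f \<in> V" "g = padd a x" "x \<in> V"
    then have "padd f g = padd a (padd f x)" by (simp add: padd_ac)
    then show ?thesis using * subspace2D(3)[OF V] by auto
  next
    fix x assume *: "g \<in> V" "f = padd a x" "x \<in> V"
    then have "padd f g = padd a (padd x g)" by (simp add: padd_ac)
    then show ?thesis using * subspace2D(3)[OF V] by auto
  qed (use subspace2D(3)[OF V] in auto)
  then show ?thesis using subspace2D[OF V] a by (auto simp: subspace2_def)
qed

text \<open>The span of \<open>V\<close> and \<open>a\<close> is just two cosets of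
  \<open>V\<close>, and lying outside \<open>V\<close> is an additive function on it;
  \<open>y\<close> represents this function.\<close>

lemma separation:
  assumes Q: "finite Q" and V: "subspace2 Q V" and a: "a \<in> Gsp Q" "a \<notin> V"
  obtains y where "y \<in> Gsp Q" "\<And>v. v \<in> V \<Longrightarrow> \<not> omega Q y v" "omega Q y a"
proof -
  have notin: "padd a v \<notin> V" if "v \<in> V" for v
    using a subspace2D(3)[OF V, of v "padd a v"] that by (metis padd_ac(1) padd_simps(4))
  have "(padd v w \<notin> V) = ((v \<notin> V) \<noteq> (w \<notin> V))"
    if "v \<in> V \<union> padd a ` V" "w \<in> V \<union> padd a ` V" for v w
    using that
  proof (elim UnE imageE)
    fix x y assume "v = padd a x" "x \<in> V" "w = padd a y" "y \<in> V"
    moreover have "padd (padd a x) (padd a y) = padd x y"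
      by (metis padd_ac padd_simps(4))
    ultimately show ?thesis using subspace2D(3)[OF V] notin by auto
  next
    fix x assume *: "v \<in> V" "w = padd a x" "x \<in> V"
    then have "padd v w = padd a (padd v x)" by (simp add: padd_ac)
    then show ?thesis using * subspace2D(3)[OF V] notin by auto
  next
    fix x assume *: "w \<in> V" "v = padd a x" "x \<in> V"
    then have "padd v w = padd a (padd x w)" by (simp add: padd_ac)
    then show ?thesis using * subspace2D(3)[OF V] notin by auto
  qed (use subspace2D(3)[OF V] in auto)
  then obtain y where y: "y \<in> Gsp Q" "\<And>v. v \<in> V \<union> padd a ` V \<Longrightarrow> omega Q y v = (v \<notin> V)"
    using functional_representable[OF Q subspace2_adjoin[OF V a(1)], of "\<lambda>v. v \<notin> V"] by metis
  have "a \<in> padd a ` V" using image_eqI[of a "padd a" pzero V] subspace2D(2)[OF V] by simp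
  then show ?thesis
    using that[OF y(1)] y(2) a(2) by simp
qed

text \<open>A single transvection moves \<open>a\<close> to \<open>b\<close> if \<open>\<omega>(a,b) = 1\<close>; otherwise pass through \<open>a + y\<close> with
  \<open>y\<close> orthogonal to \<open>V\<close> and \<open>\<omega>(y,a) = \<omega>(y,b) = 1\<close>.\<close>

lemma transvections_move:
  assumes Q: "finite Q" and V: "subspace2 Q V" and u: "u \<in> transvections Q"
    and a: "u w \<in> Gsp Q - V" and b: "b \<in> Gsp Q - V"
    and orth: "\<And>v. v \<in> V \<Longrightarrow> omega Q v (u w) = omega Q v b"
  obtains u' where "u' \<in> transvections Q" "u' w = b" "\<And>x. u x \<in> V \<Longrightarrow> u' x = u x"
proof -
  define a' where "a' = u w"
  consider "omega Q a' b" | "a' = b" | "\<not> omega Q a' b" by blast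
  then show ?thesis
  proof cases
    case 1
    \<comment> \<open>Since \<omega>(a', a'+b) = \<omega>(a', b) = 1, \<open>a'\<close> goes to a' +
      (a'+b) = b. Vectors of \<open>V\<close> pair equally with \<open>a'\<close> and
      \<open>b\<close>, so they stay fixed.\<close>
    have "transvection Q (padd a' b) \<circ> u \<in> transvections Q"
      using a b u by (auto simp: a'_def intro: transvections.step)
    then show ?thesis
      by (rule that) (use 1 orth Q in
        \<open>auto simp: transvection_def omega_padd_right a'_def[symmetric]\<close>)
  next
    case 2
    then show ?thesis using that u by (auto simp: a'_def)
  next
    case 3
    obtain y1 where y1: "y1 \<in> Gsp Q" "\<And>v. v \<in> V \<Longrightarrow> \<not> omega Q y1 v" "omega Q y1 a'"
      using separation[OF Q V, of a'] a by (auto simp: a'_def)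
    obtain y2 where y2: "y2 \<in> Gsp Q" "\<And>v. v \<in> V \<Longrightarrow> \<not> omega Q y2 v" "omega Q y2 b"
      using separation[OF Q V, of b] b by auto
    have "\<exists>y\<in>Gsp Q. (\<forall>v\<in>V. \<not> omega Q y v) \<and> omega Q y a' \<and> omega Q y b"
    proof (cases "omega Q y1 b \<or> omega Q y2 a'")
      case True
      then show ?thesis using y1 y2 by blast
    next
      case False
      \<comment> \<open>Here \<open>y1\<close> pairs to 1 with \<open>a'\<close> only and
        \<open>y2\<close> with \<open>b\<close> only, so their sum does so with both.\<close>
      then show ?thesis using y1 y2 Q by (intro bexI[of _ "padd y1 y2"]) (auto simp: omega_padd_left)
    qed
    then obtain y where y: "y \<in> Gsp Q" "\<And>v. v \<in> V \<Longrightarrow> \<not> omega Q v y" "omega Q a' y" "omega Q y b"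
      by (metis omega_sym)
    \<comment> \<open>The first transvection sends \<open>a'\<close> to a'+y. Now \<omega>(a'+y, b)
      = 0+1, so the direct move of case 1 takes a'+y to \<open>b\<close>. Both fix \<open>V\<close>
      pointwise.\<close>
    have "transvection Q (padd (padd a' y) b) \<circ> (transvection Q y \<circ> u) \<in> transvections Q"
      using a b u y by (intro transvections.step) (auto simp: a'_def)
    then show ?thesis
      by (rule that) (use 3 y orth Q in
        \<open>auto simp: transvection_def omega_padd_right omega_padd_left a'_def[symmetric] omega_sym[of Q y a']\<close>)
  qed
qed

lemma witt_extension:
  assumes Q: "finite Q" and W: "subspace2 Q W"
    and t: "t \<in> W \<rightarrow> Gsp Q"
    and add: "\<And>v w. v \<in> W \<Longrightarrow> w \<in> W \<Longrightarrow> t (padd v w) = padd (t v) (t w)"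
    and iso: "\<And>v w. v \<in> W \<Longrightarrow> w \<in> W \<Longrightarrow> omega Q (t v) (t w) = omega Q v w"
    and inj: "\<And>w. w \<in> W \<Longrightarrow> t w = pzero \<Longrightarrow> w = pzero"
  obtains u where "u \<in> transvections Q" "\<And>w. w \<in> W \<Longrightarrow> u w = t w"
proof -
  let ?P = "{W0. subspace2 Q W0 \<and> W0 \<subseteq> W \<and> (\<exists>u\<in>transvections Q. \<forall>w\<in>W0. u w = t w)}"
  have WG: "W \<subseteq> Gsp Q" using subspace2D(1)[OF W] .
  have t0: "t pzero = pzero" using add[of pzero pzero] subspace2D(2)[OF W] by simp
  have "finite W" using finite_subset[OF WG finite_Gsp[OF Q]] .
  then have "finite ?P" by (auto intro: finite_subset[of _ "Pow W"])
  moreover have "{pzero} \<in> ?P"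
    using t0 subspace2D(2)[OF W] by (auto simp: subspace2_def intro!: bexI[OF _ transvections.id])
  ultimately obtain W0 where W0: "W0 \<in> ?P" and max: "\<And>V. V \<in> ?P \<Longrightarrow> W0 \<subseteq> V \<Longrightarrow> W0 = V"
    using finite_has_maximal[of ?P] by (metis (no_types, lifting) empty_iff)
  then obtain u where u: "u \<in> transvections Q" "\<And>w. w \<in> W0 \<Longrightarrow> u w = t w"
    and W0W: "W0 \<subseteq> W" and sub: "subspace2 Q W0" by blast
  have isou: "isometry Q u" using transvections_isometry[OF Q u(1)] .
  have "W0 = W"
  proof (rule ccontr)
    assume "W0 \<noteq> W"
    then obtain w where w: "w \<in> W" "w \<notin> W0" using W0W by auto
    define V where "V = t ` W0"
    have V: "subspace2 Q V"
      unfolding subspace2_def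
    proof (intro conjI ballI)
      show "V \<subseteq> Gsp Q" using t W0W by (auto simp: V_def)
      show "pzero \<in> V" using t0 subspace2D(2)[OF sub] by (metis V_def imageI)
      fix f g assume "f \<in> V" "g \<in> V"
      then obtain x y where "x \<in> W0" "y \<in> W0" "f = t x" "g = t y" by (auto simp: V_def)
      then show "padd f g \<in> V"
        using add[of x y] W0W subspace2D(3)[OF sub, of x y] by (metis V_def imageI subsetD)
    qed
    have tw: "t w \<notin> V"
    proof
      assume "t w \<in> V"
      then obtain x where x: "x \<in> W0" "t w = t x" by (auto simp: V_def)
      then have "t (padd w x) = pzero" using add w W0W by auto
      then have "w = x" using inj[of "padd w x"] subspace2D(3)[OF W] w x W0W by auto
      with x w show False by simp
    qed
    have uw: "u w \<notin> V"
    proof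
      assume "u w \<in> V"
      then obtain x where x: "x \<in> W0" "u w = u x" using u(2) by (auto simp: V_def)
      moreover have "inj_on u (Gsp Q)" using isometry_bij[OF Q isou] by (simp add: bij_betw_def)
      ultimately have "w = x" using w W0W WG by (auto dest: inj_onD)
      with x w show False by simp
    qed
    have "omega Q v (u w) = omega Q v (t w)" if "v \<in> V" for v
    proof -
      obtain x where x: "x \<in> W0" "v = t x" using \<open>v \<in> V\<close> by (auto simp: V_def)
      then have "omega Q v (u w) = omega Q (u x) (u w)" using u(2) by simp
      also have "\<dots> = omega Q (t x) (t w)"
        using isometryD(2)[OF isou, of x w] iso[of x w] x w W0W WG by auto
      finally show ?thesis using x by simp
    qed
    moreover have "u w \<in> Gsp Q - V" "t w \<in> Gsp Q - V"
      using uw tw isometryD(1)[OF isou, of w] t w WG by auto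
    ultimately obtain u' where u': "u' \<in> transvections Q" "u' w = t w"
      "\<And>x. u x \<in> V \<Longrightarrow> u' x = u x"
      using transvections_move[OF Q V u(1)] by metis
    have isou': "isometry Q u'" using transvections_isometry[OF Q u'(1)] .
    have u't: "u' x = t x" if "x \<in> W0" for x
      using u'(3)[of x] u(2)[of x] that by (auto simp: V_def)
    let ?V = "W0 \<union> padd w ` W0"
    have "u' v = t v" if "v \<in> ?V" for v
      using that u't u'(2) w W0W WG isometry_padd[OF Q isou', of w] add[of w]
      by (auto simp: subset_iff)
    moreover have "subspace2 Q ?V" using subspace2_adjoin[OF sub] w WG by auto
    moreover have "?V \<subseteq> W" using w W0W subspace2D(3)[OF W] by auto
    ultimately have "?V \<in> ?P" using u'(1) by blast
    from max[OF this] have "w \<in> W0"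
      using subspace2D(2)[OF sub] image_eqI[of w "padd w" pzero W0] by auto
    with w show False by simp
  qed
  then show ?thesis using that u by blast
qed

subsection \<open>Operators, Pauli matrices and Clifford unitaries\<close>

lemma op_eq_refl [simp]: "op_eq Q K K"
  by (simp add: op_eq_def)

lemma op_eq_sym: "op_eq Q K L \<Longrightarrow> op_eq Q L K"
  by (simp add: op_eq_def)

lemma op_eq_trans [trans]: "op_eq Q K L \<Longrightarrow> op_eq Q L N \<Longrightarrow> op_eq Q K N"
  by (simp add: op_eq_def)

lemma op_eq_scale: "op_eq Q K L \<Longrightarrow> op_eq Q (\<lambda>y x. s * K y x) (\<lambda>y x. s * L y x)"
  by (simp add: op_eq_def)

lemma mmul_cong: "op_eq Q K K' \<Longrightarrow> op_eq Q L L' \<Longrightarrow> op_eq Q (mmul Q K L) (mmul Q K' L')"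
  by (simp add: op_eq_def mmul_def)

lemma mmul_assoc: "mmul Q (mmul Q K L) N = mmul Q K (mmul Q L N)"
proof (intro ext)
  fix y x
  have "mmul Q (mmul Q K L) N y x = (\<Sum>z\<in>basis Q. \<Sum>w\<in>basis Q. K y w * L w z * N z x)"
    by (simp add: mmul_def sum_distrib_right)
  also have "\<dots> = (\<Sum>w\<in>basis Q. \<Sum>z\<in>basis Q. K y w * L w z * N z x)"
    by (rule sum.swap)
  also have "\<dots> = mmul Q K (mmul Q L N) y x"
    by (simp add: mmul_def sum_distrib_left mult.assoc)
  finally show "mmul Q (mmul Q K L) N y x = mmul Q K (mmul Q L N) y x" .
qed

lemma mmul_scale:
  "mmul Q (\<lambda>y x. s * K y x) L = (\<lambda>y x. s * mmul Q K L y x)"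
  "mmul Q K (\<lambda>y x. s * L y x) = (\<lambda>y x. s * mmul Q K L y x)"
  by (auto simp: mmul_def fun_eq_iff sum_distrib_left mult.assoc mult.left_commute)

lemma mmul_add:
  "mmul Q (\<lambda>y x. K y x + K' y x) L = (\<lambda>y x. mmul Q K L y x + mmul Q K' L y x)"
  "mmul Q L (\<lambda>y x. K y x + K' y x) = (\<lambda>y x. mmul Q L K y x + mmul Q L K' y x)"
  by (auto simp: mmul_def fun_eq_iff algebra_simps sum.distrib)

lemma mmul_id:
  assumes "finite Q"
  shows "op_eq Q (mmul Q id_op K) K" "op_eq Q (mmul Q K id_op) K"
  using assms by (auto simp: op_eq_def mmul_def id_op_def of_bool_def[symmetric]
      if_distrib[of "\<lambda>c. c * _"] if_distrib[of "\<lambda>c. _ * c"] sum.delta sum.delta' cong: if_cong)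

lemma adj_mmul: "adj (mmul Q K L) = mmul Q (adj L) (adj K)"
  by (simp add: adj_def mmul_def fun_eq_iff mult.commute)

lemma adj_adj [simp]: "adj (adj K) = K"
  by (simp add: adj_def fun_eq_iff)

lemma adj_cong: "op_eq Q K L \<Longrightarrow> op_eq Q (adj K) (adj L)"
  by (simp add: op_eq_def adj_def)

lemma unitary_on_adj: "unitary_on Q U \<Longrightarrow> unitary_on Q (adj U)"
  by (simp add: unitary_on_def)

lemma mmul_cancel:
  assumes Q: "finite Q" and KL: "op_eq Q (mmul Q K L) id_op"
  shows "op_eq Q (mmul Q K (mmul Q L N)) N" "op_eq Q (mmul Q (mmul Q N K) L) N"
  using mmul_cong[OF KL op_eq_refl[of Q N]] mmul_cong[OF op_eq_refl[of Q N] KL]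
    mmul_id[OF Q, of N] op_eq_trans by (simp_all add: mmul_assoc) blast+

lemma unitary_on_mmul:
  assumes Q: "finite Q" and U: "unitary_on Q U" and V: "unitary_on Q V"
  shows "unitary_on Q (mmul Q U V)"
proof -
  have "op_eq Q (mmul Q (mmul Q (mmul Q U V) (adj V)) (adj U)) (mmul Q U (adj U))"
    using V by (intro mmul_cong mmul_cancel Q) (auto simp: unitary_on_def)
  moreover have "op_eq Q (mmul Q (adj V) (mmul Q (adj U) (mmul Q U V))) (mmul Q (adj V) V)"
    using U by (intro mmul_cong mmul_cancel Q) (auto simp: unitary_on_def)
  ultimately show ?thesis
    using U V by (auto simp: unitary_on_def adj_mmul mmul_assoc intro: op_eq_trans)
qed

text \<open>Provides an entry at which an equation between multiples of one unitary can be divided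
  to compare the scalars.\<close>

lemma unitary_on_nonzero:
  assumes U: "unitary_on Q U"
  obtains y x where "y \<in> basis Q" "x \<in> basis Q" "U y x \<noteq> 0"
proof -
  let ?o = "\<lambda>_. False"
  have o: "?o \<in> basis Q" by (simp add: basis_def)
  have "(\<Sum>x\<in>basis Q. U ?o x * adj U x ?o) = 1"
    using U o by (simp add: unitary_on_def op_eq_def mmul_def id_op_def)
  then have "\<exists>x\<in>basis Q. U ?o x \<noteq> 0"
    by (metis (mono_tags, lifting) mult_zero_left sum.neutral zero_neq_one)
  then show ?thesis using that o by blast
qed

text \<open>The scalar in \<sigma>_p \<sigma>_q = phase * \<sigma>_(p+q): 1 for commuting factors, i
  for the cyclic pairs (x,y), (y,z), (z,x), and -i for the reversed pairs.\<close>

definition sig_phase :: "bool \<times> bool \<Rightarrow> bool \<times> bool \<Rightarrow> complex" where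
  "sig_phase p q =
     (if (fst p \<and> snd q) = (snd p \<and> fst q) then 1
      else if (p, q) \<in> {((True, False), (True, True)), ((True, True), (False, True)),
                        ((False, True), (True, False))} then \<i> else - \<i>)"

definition pauli_phase :: "'q set \<Rightarrow> 'q pauli \<Rightarrow> 'q pauli \<Rightarrow> complex" where
  "pauli_phase Q f g = (\<Prod>q\<in>Q. sig_phase (f q) (g q))"

lemma sig1_mult:
  "sig1 (fst p) (snd p) y False * sig1 (fst q) (snd q) False x +
   sig1 (fst p) (snd p) y True * sig1 (fst q) (snd q) True x =
   sig_phase p q * sig1 (fst p \<noteq> fst q) (snd p \<noteq> snd q) y x"
  by (cases p; cases q) (auto simp: sig1_def sig_phase_def)

lemma pauli_mmul:
  assumes "finite Q"
  shows "mmul Q (pauli_op Q f) (pauli_op Q g) =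
     (\<lambda>y x. pauli_phase Q f g * pauli_op Q (padd f g) y x)"
proof (intro ext)
  fix y x
  let ?F = "\<lambda>q b. sig1 (fst (f q)) (snd (f q)) (y q) b * sig1 (fst (g q)) (snd (g q)) b (x q)"
  have "mmul Q (pauli_op Q f) (pauli_op Q g) y x = (\<Sum>z\<in>basis Q. \<Prod>q\<in>Q. ?F q (z q))"
    by (simp add: mmul_def pauli_op_def prod.distrib)
  also have "\<dots> = (\<Prod>q\<in>Q. ?F q False + ?F q True)"
    using assms by (rule sum_prod_basis)
  also have "\<dots> = pauli_phase Q f g * pauli_op Q (padd f g) y x"
    unfolding sig1_mult by (simp add: pauli_phase_def pauli_op_def padd_def prod.distrib)
  finally show "mmul Q (pauli_op Q f) (pauli_op Q g) y x =
      pauli_phase Q f g * pauli_op Q (padd f g) y x" .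
qed

text \<open>On each qubit the phase is 1 for commuting factors and i or -i for anticommuting
  ones.\<close>

lemma pauli_phase_square: "(pauli_phase Q f g)\<^sup>2 = omega_sign Q f g"
  unfolding pauli_phase_def omega_sign_def prod_power_distrib
  by (intro prod.cong) (auto simp: sig_phase_def)

lemma pauli_phase_swap: "pauli_phase Q f g = omega_sign Q f g * pauli_phase Q g f"
  unfolding pauli_phase_def omega_sign_def prod.distrib[symmetric]
  by (intro prod.cong) (auto simp: sig_phase_def prod_eq_iff)

lemma pauli_phase_self [simp]: "pauli_phase Q f f = 1"
  by (simp add: pauli_phase_def sig_phase_def conj_commute)

lemma pauli_commute:
  "finite Q \<Longrightarrow> mmul Q (pauli_op Q f) (pauli_op Q g) =
     (\<lambda>y x. omega_sign Q f g * mmul Q (pauli_op Q g) (pauli_op Q f) y x)"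
  using pauli_phase_swap[of Q f g] padd_ac(1)[of g f] by (simp add: pauli_mmul mult.assoc)

lemma pauli_op_pzero: "finite Q \<Longrightarrow> op_eq Q (pauli_op Q pzero) id_op"
  by (force simp: op_eq_def pauli_op_def pzero_def sig1_def id_op_def basis_def fun_eq_iff)

lemma pauli_square: "finite Q \<Longrightarrow> op_eq Q (mmul Q (pauli_op Q f) (pauli_op Q f)) id_op"
  by (simp add: pauli_mmul pauli_op_pzero)

lemma adj_pauli [simp]: "adj (pauli_op Q f) = pauli_op Q f"
  by (auto simp: adj_def pauli_op_def fun_eq_iff sig1_def intro!: prod.cong)

lemma pauli_unitary: "finite Q \<Longrightarrow> unitary_on Q (pauli_op Q f)"
  by (simp add: unitary_on_def pauli_square)

text \<open>Conjugation is written as an intertwining relation, without the adjoint: products then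
  compose by associativity, and the relation can be applied directly to eigenvectors.\<close>

definition implements :: "'q set \<Rightarrow> 'q op \<Rightarrow> ('q pauli \<Rightarrow> 'q pauli) \<Rightarrow> bool" where
  "implements Q U u \<longleftrightarrow> unitary_on Q U \<and> u \<in> Gsp Q \<rightarrow> Gsp Q \<and>
     (\<forall>f\<in>Gsp Q. \<exists>s\<in>{1, -1}.
        op_eq Q (mmul Q U (pauli_op Q f)) (\<lambda>y x. s * mmul Q (pauli_op Q (u f)) U y x))"

lemma implementsD:
  assumes "implements Q U u"
  shows "unitary_on Q U" "f \<in> Gsp Q \<Longrightarrow> u f \<in> Gsp Q"
    "f \<in> Gsp Q \<Longrightarrow> \<exists>s\<in>{1, -1}.
        op_eq Q (mmul Q U (pauli_op Q f)) (\<lambda>y x. s * mmul Q (pauli_op Q (u f)) U y x)"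
  using assms by (auto simp: implements_def)

lemma unitary_move:
  assumes Q: "finite Q" and U: "unitary_on Q U"
  shows "op_eq Q (mmul Q K (adj U)) L \<longleftrightarrow> op_eq Q K (mmul Q L U)"
proof
  assume "op_eq Q (mmul Q K (adj U)) L"
  from mmul_cong[OF this op_eq_refl[of Q U]] show "op_eq Q K (mmul Q L U)"
    using mmul_cancel(2)[OF Q, of "adj U" U K] U unfolding unitary_on_def
    by (blast intro: op_eq_trans op_eq_sym)
next
  assume "op_eq Q K (mmul Q L U)"
  from mmul_cong[OF this op_eq_refl[of Q "adj U"]] show "op_eq Q (mmul Q K (adj U)) L"
    using mmul_cancel(2)[OF Q, of U "adj U" L] U unfolding unitary_on_def
    by (blast intro: op_eq_trans op_eq_sym)
qed

lemma clifford_iff_implements: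
  assumes "finite Q"
  shows "clifford Q U \<longleftrightarrow> (\<exists>u. implements Q U u)"
proof (cases "unitary_on Q U")
  case True
  have "(\<forall>f\<in>Gsp Q. u f \<in> Gsp Q \<and> (\<exists>s::complex. (s = 1 \<or> s = -1) \<and>
      op_eq Q (mmul Q (mmul Q U (pauli_op Q f)) (adj U)) (\<lambda>y x. s * pauli_op Q (u f) y x)))
    \<longleftrightarrow> u \<in> Gsp Q \<rightarrow> Gsp Q \<and> (\<forall>f\<in>Gsp Q. \<exists>s\<in>{1, -1}.
        op_eq Q (mmul Q U (pauli_op Q f)) (\<lambda>y x. s * mmul Q (pauli_op Q (u f)) U y x))" for u
    unfolding unitary_move[OF assms True] mmul_scale Pi_iff Bex_def insert_iff empty_iff by blast
  with True show ?thesis by (simp only: clifford_def implements_def simp_thms)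
qed (simp add: clifford_def implements_def)

text \<open>The sign by which \<sigma>(f) and \<sigma>(g) commute is (-1)^\<omega>(f,g). Moving
  \<open>U\<close> past both products, in either order, carries this sign over to the images; the
  signs of \<open>U\<close> itself occur on both sides.\<close>

lemma implements_isometry:
  assumes Q: "finite Q" and U: "implements Q U u"
  shows "isometry Q u"
  unfolding isometry_def
proof (intro conjI ballI)
  show "u \<in> Gsp Q \<rightarrow> Gsp Q" using U by (simp add: implements_def)
  fix f g assume fg: "f \<in> Gsp Q" "g \<in> Gsp Q"
  obtain s where s: "s \<in> {1, -1}"
    "op_eq Q (mmul Q U (pauli_op Q f)) (\<lambda>y x. s * mmul Q (pauli_op Q (u f)) U y x)"
    using implementsD(3)[OF U fg(1)] by blast
  obtain t where t: "t \<in> {1, -1}"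
    "op_eq Q (mmul Q U (pauli_op Q g)) (\<lambda>y x. t * mmul Q (pauli_op Q (u g)) U y x)"
    using implementsD(3)[OF U fg(2)] by blast
  have two: "op_eq Q (mmul Q U (mmul Q (pauli_op Q f) (pauli_op Q g)))
      (\<lambda>y x. s * t * mmul Q (mmul Q (pauli_op Q (u f)) (pauli_op Q (u g))) U y x)"
    if s: "op_eq Q (mmul Q U (pauli_op Q f)) (\<lambda>y x. s * mmul Q (pauli_op Q (u f)) U y x)"
      and t: "op_eq Q (mmul Q U (pauli_op Q g)) (\<lambda>y x. t * mmul Q (pauli_op Q (u g)) U y x)"
    for f g s t
  proof -
    have "op_eq Q (mmul Q U (mmul Q (pauli_op Q f) (pauli_op Q g)))
        (\<lambda>y x. s * mmul Q (pauli_op Q (u f)) (mmul Q U (pauli_op Q g)) y x)"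
      using mmul_cong[OF s op_eq_refl[of Q "pauli_op Q g"]] by (simp only: mmul_scale mmul_assoc)
    also have "op_eq Q (\<lambda>y x. s * mmul Q (pauli_op Q (u f)) (mmul Q U (pauli_op Q g)) y x)
        (\<lambda>y x. s * (t * mmul Q (pauli_op Q (u f)) (mmul Q (pauli_op Q (u g)) U) y x))"
      using op_eq_scale[OF mmul_cong[OF op_eq_refl t], of s "pauli_op Q (u f)"]
      by (simp only: mmul_scale)
    finally show ?thesis by (simp only: mmul_assoc mult.assoc)
  qed
  \<comment> \<open>A nonzero entry of the unitary common to both expansions, so that the scalars
    may be cancelled.\<close>
  obtain y x where yx: "y \<in> basis Q" "x \<in> basis Q"
    "mmul Q (mmul Q (pauli_op Q (u g)) (pauli_op Q (u f))) U y x \<noteq> 0"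
    using unitary_on_nonzero[OF unitary_on_mmul[OF Q unitary_on_mmul[OF Q
      pauli_unitary[OF Q] pauli_unitary[OF Q]] implementsD(1)[OF U]]] by metis
  have "omega_sign Q f g * (t * s) = s * t * omega_sign Q (u f) (u g)"
    using two[OF s(2) t(2)] two[OF t(2) s(2)] yx
    unfolding pauli_commute[OF Q, of f g] pauli_commute[OF Q, of "u f" "u g"] mmul_scale op_eq_def
    by fastforce
  then show "omega Q (u f) (u g) = omega Q f g"
    using s(1) t(1) Q by (auto simp: omega_sign_eq split: if_splits)
qed

lemma implements_mmul:
  assumes Q: "finite Q" and U: "implements Q U u" and V: "implements Q V v"
  shows "implements Q (mmul Q U V) (u \<circ> v)"
  unfolding implements_def
proof (intro conjI ballI)
  show "unitary_on Q (mmul Q U V)"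
    using unitary_on_mmul[OF Q] U V by (simp add: implements_def)
  show "u \<circ> v \<in> Gsp Q \<rightarrow> Gsp Q" using U V by (auto simp: implements_def)
  fix f assume f: "f \<in> Gsp Q"
  obtain t where t: "t \<in> {1, -1}"
    "op_eq Q (mmul Q V (pauli_op Q f)) (\<lambda>y x. t * mmul Q (pauli_op Q (v f)) V y x)"
    using implementsD(3)[OF V f] by blast
  obtain s where s: "s \<in> {1, -1}"
    "op_eq Q (mmul Q U (pauli_op Q (v f))) (\<lambda>y x. s * mmul Q (pauli_op Q (u (v f))) U y x)"
    using implementsD(3)[OF U implementsD(2)[OF V f]] by blast
  have "op_eq Q (mmul Q (mmul Q U V) (pauli_op Q f))
      (\<lambda>y x. t * mmul Q (mmul Q U (pauli_op Q (v f))) V y x)"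
    using mmul_cong[OF op_eq_refl t(2), of U] by (simp add: mmul_scale mmul_assoc)
  also have "op_eq Q (\<lambda>y x. t * mmul Q (mmul Q U (pauli_op Q (v f))) V y x)
      (\<lambda>y x. t * s * mmul Q (pauli_op Q (u (v f))) (mmul Q U V) y x)"
    using op_eq_scale[OF mmul_cong[OF s(2) op_eq_refl, of V], of t]
    by (simp add: mmul_scale mmul_assoc mult.assoc)
  finally show "\<exists>s\<in>{1, -1}. op_eq Q (mmul Q (mmul Q U V) (pauli_op Q f))
      (\<lambda>y x. s * mmul Q (pauli_op Q ((u \<circ> v) f)) (mmul Q U V) y x)"
    using s(1) t(1) by (intro bexI[of _ "t * s"]) auto
qed

text \<open>Conjugation by a Pauli operator changes nothing but signs, which is why Pauli operators
  can later correct signs without disturbing the isometry.\<close>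

lemma implements_pauli:
  assumes Q: "finite Q"
  shows "implements Q (pauli_op Q g) id"
  unfolding implements_def
proof (intro conjI ballI)
  fix f
  show "\<exists>s\<in>{1, -1}. op_eq Q (mmul Q (pauli_op Q g) (pauli_op Q f))
      (\<lambda>y x. s * mmul Q (pauli_op Q (id f)) (pauli_op Q g) y x)"
    using Q by (intro bexI[of _ "omega_sign Q g f"])
      (simp_all add: pauli_commute[OF Q, of g f] omega_sign_eq)
qed (use pauli_unitary[OF Q] in auto)

text \<open>This is exp(-i(pi/4)\<sigma>(h)), expanded by means of \<sigma>(h)^2 = I.\<close>

definition transvection_op :: "'q set \<Rightarrow> 'q pauli \<Rightarrow> 'q op" where
  "transvection_op Q h = (\<lambda>y x. complex_of_real (1 / sqrt 2) * id_op y x +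
     (- \<i> * complex_of_real (1 / sqrt 2)) * pauli_op Q h y x)"

text \<open>If \<sigma>(f) commutes with \<sigma>(h), it commutes with the gate. Otherwise
  conjugation yields -i \<sigma>(h)\<sigma>(f), and the product contributes a phase i or -i, which
  makes the result a real sign times \<sigma>(f+h).\<close>

lemma implements_transvection:
  assumes Q: "finite Q" and h: "h \<in> Gsp Q"
  shows "implements Q (transvection_op Q h) (transvection Q h)"
  unfolding implements_def
proof (intro conjI ballI)
  let ?U = "transvection_op Q h" and ?r = "complex_of_real (1 / sqrt 2)"
  have r: "?r * ?r = 1 / 2" by (simp flip: of_real_mult)
  have left: "op_eq Q (mmul Q ?U K) (\<lambda>y x. ?r * K y x + (- \<i> * ?r) * mmul Q (pauli_op Q h) K y x)"
    and right: "op_eq Q (mmul Q K ?U) (\<lambda>y x. ?r * K y x + (- \<i> * ?r) * mmul Q K (pauli_op Q h) y x)"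
    for K
    using mmul_id[OF Q, of K] unfolding transvection_op_def mmul_add mmul_scale op_eq_def by auto
  have adjU: "adj ?U = (\<lambda>y x. ?r * id_op y x + (\<i> * ?r) * pauli_op Q h y x)"
  proof -
    have "cnj (pauli_op Q h x y) = pauli_op Q h y x" for x y by (metis adj_def adj_pauli)
    then show ?thesis by (auto simp: adj_def transvection_op_def fun_eq_iff id_op_def)
  qed
  have "op_eq Q (mmul Q ?U (adj ?U)) id_op"
  proof -
    have "mmul Q ?U (adj ?U) y x = id_op y x" if yx: "y \<in> basis Q" "x \<in> basis Q" for y x
    proof -
      have "mmul Q ?U (adj ?U) y x = ?r * adj ?U y x +
          (- \<i> * ?r) * (?r * mmul Q (pauli_op Q h) id_op y x +
            (\<i> * ?r) * mmul Q (pauli_op Q h) (pauli_op Q h) y x)"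
        using left[of "adj ?U"] yx unfolding op_eq_def by (simp only: adjU mmul_add mmul_scale)
      also have "\<dots> = ?r * (?r * id_op y x + (\<i> * ?r) * pauli_op Q h y x) +
          (- \<i> * ?r) * (?r * pauli_op Q h y x + (\<i> * ?r) * id_op y x)"
        using mmul_id(2)[OF Q, of "pauli_op Q h"] pauli_square[OF Q, of h] yx
        by (simp add: op_eq_def adjU)
      also have "\<dots> = 2 * (?r * ?r) * id_op y x"
        by (simp add: algebra_simps)
      finally show ?thesis unfolding r by simp
    qed
    then show ?thesis by (simp add: op_eq_def)
  qed
  moreover have "op_eq Q (mmul Q (adj ?U) ?U) id_op"
  proof -
    have "mmul Q (adj ?U) ?U y x = id_op y x" if yx: "y \<in> basis Q" "x \<in> basis Q" for y x
    proof -
      have "mmul Q (adj ?U) ?U y x = ?r * adj ?U y x +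
          (- \<i> * ?r) * (?r * mmul Q id_op (pauli_op Q h) y x +
            (\<i> * ?r) * mmul Q (pauli_op Q h) (pauli_op Q h) y x)"
        using right[of "adj ?U"] yx unfolding op_eq_def by (simp only: adjU mmul_add mmul_scale)
      also have "\<dots> = ?r * (?r * id_op y x + (\<i> * ?r) * pauli_op Q h y x) +
          (- \<i> * ?r) * (?r * pauli_op Q h y x + (\<i> * ?r) * id_op y x)"
        using mmul_id(1)[OF Q, of "pauli_op Q h"] pauli_square[OF Q, of h] yx
        by (simp add: op_eq_def adjU)
      also have "\<dots> = 2 * (?r * ?r) * id_op y x"
        by (simp add: algebra_simps)
      finally show ?thesis unfolding r by simp
    qed
    then show ?thesis by (simp add: op_eq_def)
  qed
  ultimately show "unitary_on Q ?U" by (simp add: unitary_on_def)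
  show "transvection Q h \<in> Gsp Q \<rightarrow> Gsp Q" using h by (auto simp: transvection_def)
  fix f
  show "\<exists>s\<in>{1, -1}. op_eq Q (mmul Q ?U (pauli_op Q f))
      (\<lambda>y x. s * mmul Q (pauli_op Q (transvection Q h f)) ?U y x)"
  proof (cases "omega Q f h")
    case False
    then have comm: "mmul Q (pauli_op Q h) (pauli_op Q f) = mmul Q (pauli_op Q f) (pauli_op Q h)"
      using pauli_commute[OF Q, of h f] Q by (simp add: omega_sign_eq omega_sym[of Q h f])
    have "op_eq Q (mmul Q ?U (pauli_op Q f)) (mmul Q (pauli_op Q f) ?U)"
      using op_eq_trans[OF left[of "pauli_op Q f", unfolded comm] op_eq_sym[OF right]] .
    with False show ?thesis by (intro bexI[of _ 1]) (auto simp: transvection_def)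
  next
    case True
    define p where "p = pauli_phase Q h f"
    \<comment> \<open>Anticommutation forces \<open>p\<close> to be i or -i, so that - i p is the
      sign 1 or -1 demanded by \<open>implements\<close>.\<close>
    have p2: "p * p = -1"
      using pauli_phase_square[of Q h f] True Q
      by (simp add: p_def power2_eq_square omega_sign_eq omega_sym[of Q h f])
    then have p: "p = \<i> \<or> p = - \<i>"
      by (metis i_squared power2_eq_iff power2_eq_square)
    have hf: "mmul Q (pauli_op Q h) (pauli_op Q f) = (\<lambda>y x. p * pauli_op Q (padd f h) y x)"
      using pauli_mmul[OF Q, of h f] by (simp add: p_def padd_ac)
    have fh_h: "mmul Q (pauli_op Q (padd f h)) (pauli_op Q h) = (\<lambda>y x. p * pauli_op Q f y x)"
    proof -
      \<comment> \<open>On each qubit, the pairs (h, f) and (f+h, h) differ by a cyclic shift of the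
        triple h, f, f+h, and the phase is invariant under such shifts.\<close>
      have "pauli_phase Q (padd f h) h = p"
        unfolding p_def pauli_phase_def
        by (intro prod.cong) (auto simp: sig_phase_def padd_def prod_eq_iff)
      then show ?thesis using pauli_mmul[OF Q, of "padd f h" h] by (simp add: padd_ac)
    qed
    have "op_eq Q (mmul Q ?U (pauli_op Q f))
        (\<lambda>y x. (- \<i> * p) * mmul Q (pauli_op Q (padd f h)) ?U y x)"
      unfolding op_eq_def
    proof (intro ballI)
      fix y x assume yx: "y \<in> basis Q" "x \<in> basis Q"
      let ?a = "pauli_op Q f y x" and ?b = "pauli_op Q (padd f h) y x"
      have "mmul Q ?U (pauli_op Q f) y x = ?r * ?a + (- \<i> * ?r) * (p * ?b)"
        using left[of "pauli_op Q f"] yx by (simp only: op_eq_def hf)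
      also have "\<dots> = (- \<i> * p) * (?r * ?b + (- \<i> * ?r) * (p * ?a))"
        using p by (elim disjE) (simp_all only:, simp_all add: algebra_simps)
      also have "\<dots> = (- \<i> * p) * mmul Q (pauli_op Q (padd f h)) ?U y x"
        using right[of "pauli_op Q (padd f h)"] yx by (simp only: op_eq_def fh_h)
      finally show "mmul Q ?U (pauli_op Q f) y x =
          (- \<i> * p) * mmul Q (pauli_op Q (padd f h)) ?U y x" .
    qed
    with True p show ?thesis by (intro bexI[of _ "- \<i> * p"]) (auto simp: transvection_def)
  qed
qed

lemma transvections_implemented:
  assumes Q: "finite Q" and u: "u \<in> transvections Q"
  obtains U where "implements Q U u"
proof -
  have "\<exists>U. implements Q U u"
    using u
  proof induction
    case id
    show ?case using implements_pauli[OF Q] by blast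
  next
    case (step u h)
    then show ?case using implements_mmul[OF Q] implements_transvection[OF Q] by blast
  qed
  then show ?thesis using that by blast
qed

subsection \<open>Local operators\<close>

definition restrict_pauli :: "'q set \<Rightarrow> 'q pauli \<Rightarrow> 'q pauli" where
  "restrict_pauli A f = (\<lambda>q. if q \<in> A then f q else (False, False))"

text \<open>The orthogonal direct sum of the maps \<open>u \<alpha>\<close>, the symplectic
  counterpart of \<open>tensor_local\<close>.\<close>

definition local_map :: "'q set \<Rightarrow> ('q \<Rightarrow> 'm) \<Rightarrow> ('m \<Rightarrow> 'q pauli \<Rightarrow> 'q pauli) \<Rightarrow> 'q pauli \<Rightarrow> 'q pauli"
  where "local_map Q party u f =
    (\<lambda>q. if q \<in> Q then u (party q) (restrict_pauli (pq Q party (party q)) f) q else (False, False))"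

lemma restrict_pauli_Gsp [simp]: "restrict_pauli A f \<in> Gsp A"
  by (simp add: restrict_pauli_def Gsp_def)

lemma restrict_pauli_padd:
  "restrict_pauli A (padd f g) = padd (restrict_pauli A f) (restrict_pauli A g)"
  by (auto simp: restrict_pauli_def padd_def fun_eq_iff)

lemma restrict_pauli_pzero [simp]: "restrict_pauli A pzero = pzero"
  by (simp add: restrict_pauli_def pzero_def)

lemma omega_restrict_pauli [simp]: "omega A (restrict_pauli A f) (restrict_pauli A g) = omega A f g"
  by (rule omega_cong) (auto simp: restrict_pauli_def)

lemma restrict_pauli_eq_pzero: "restrict_pauli A f = pzero \<longleftrightarrow> (\<forall>q\<in>A. f q = (False, False))"
  by (auto simp: restrict_pauli_def pzero_def fun_eq_iff)

lemma finite_pq [simp]: "finite Q \<Longrightarrow> finite (pq Q party \<alpha>)"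
  by (simp add: pq_def)

lemma local_map_Gsp [simp]: "local_map Q party u f \<in> Gsp Q"
  by (simp add: local_map_def Gsp_def)

lemma restrict_local_map:
  assumes "u \<alpha> \<in> Gsp (pq Q party \<alpha>) \<rightarrow> Gsp (pq Q party \<alpha>)"
  shows "restrict_pauli (pq Q party \<alpha>) (local_map Q party u f) =
    u \<alpha> (restrict_pauli (pq Q party \<alpha>) f)"
proof
  fix q
  have "u \<alpha> (restrict_pauli (pq Q party \<alpha>) f) \<in> Gsp (pq Q party \<alpha>)" using assms by auto
  then have "q \<notin> pq Q party \<alpha> \<Longrightarrow> u \<alpha> (restrict_pauli (pq Q party \<alpha>) f) q = (False, False)"
    by (auto simp: Gsp_def)
  then show "restrict_pauli (pq Q party \<alpha>) (local_map Q party u f) q =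
    u \<alpha> (restrict_pauli (pq Q party \<alpha>) f) q"
  proof (cases "q \<in> pq Q party \<alpha>")
    case True
    then have "q \<in> Q" "party q = \<alpha>" by (auto simp: pq_def)
    then have "local_map Q party u f q = u \<alpha> (restrict_pauli (pq Q party \<alpha>) f) q"
      by (simp add: local_map_def)
    with True show ?thesis by (simp add: restrict_pauli_def)
  qed (simp add: restrict_pauli_def[of _ "local_map Q party u f"])
qed

lemma prod_signs:
  fixes s :: "'a \<Rightarrow> complex"
  assumes "\<And>a. a \<in> A \<Longrightarrow> s a \<in> {1, -1}"
  shows "prod s A \<in> {1, -1}"
  using assms
proof (induction A rule: infinite_finite_induct)
  case (insert a A)
  then have "s a \<in> {1, -1}" "prod s A \<in> {1, -1}" by auto
  with insert(1,2) show ?case by auto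
qed auto

section \<open>Tensor products over the parties\<close>

locale parties =
  fixes M :: "'m set" and Q :: "'q set" and party :: "'q \<Rightarrow> 'm"
  assumes finM: "finite M" and finQ: "finite Q" and party: "party ` Q \<subseteq> M"
begin

lemma restrict_bits_basis [simp]: "restrict_bits A x \<in> basis A"
  by (simp add: restrict_bits_def basis_def)

lemma Gsp_eq_parties:
  assumes "f \<in> Gsp Q" "g \<in> Gsp Q"
    and "\<And>\<alpha>. \<alpha> \<in> M \<Longrightarrow> restrict_pauli (pq Q party \<alpha>) f = restrict_pauli (pq Q party \<alpha>) g"
  shows "f = g"
proof
  fix q
  show "f q = g q"
  proof (cases "q \<in> Q")
    case True
    then have "restrict_pauli (pq Q party (party q)) f q = restrict_pauli (pq Q party (party q)) g q"
      using assms(3)[of "party q"] party by auto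
    with True show ?thesis by (simp add: restrict_pauli_def pq_def)
  qed (use assms in \<open>auto simp: Gsp_def\<close>)
qed

text \<open>A bit string on \<open>Q\<close> amounts to one bit string per party. This makes matrix
  products of tensor operators computable party by party.\<close>

lemma sum_basis_parties:
  "(\<Sum>z\<in>basis Q. \<Prod>\<alpha>\<in>M. F \<alpha> (restrict_bits (pq Q party \<alpha>) z)) =
   (\<Prod>\<alpha>\<in>M. \<Sum>z\<in>basis (pq Q party \<alpha>). F \<alpha> z :: complex)"
proof -
  let ?P = "PiE M (\<lambda>\<alpha>. basis (pq Q party \<alpha>))"
  define j where "j z = (\<lambda>\<alpha>\<in>M. restrict_bits (pq Q party \<alpha>) z)" for z
  define i where "i g = (\<lambda>q. q \<in> Q \<and> g (party q) q)" for g :: "'m \<Rightarrow> 'q bits"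
  have "bij_betw j (basis Q) ?P"
  proof (rule bij_betwI[where g = i])
    show "j \<in> basis Q \<rightarrow> ?P" by (auto simp: j_def)
    show "i \<in> ?P \<rightarrow> basis Q" by (simp add: i_def basis_def)
    fix z assume "z \<in> basis Q"
    then show "i (j z) = z"
      using party by (auto simp: i_def j_def basis_def restrict_bits_def pq_def fun_eq_iff)
  next
    fix g assume g: "g \<in> ?P"
    show "j (i g) = g"
    proof
      fix \<alpha>
      show "j (i g) \<alpha> = g \<alpha>"
      proof (cases "\<alpha> \<in> M")
        case True
        then have "g \<alpha> \<in> basis (pq Q party \<alpha>)" using g by auto
        with True show ?thesis
          by (auto simp: i_def j_def basis_def restrict_bits_def pq_def fun_eq_iff)
      next
        case False
        then show ?thesis using PiE_arb[OF g] by (simp add: j_def)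
      qed
    qed
  qed
  from sum.reindex_bij_betw[OF this, of "\<lambda>g. \<Prod>\<alpha>\<in>M. F \<alpha> (g \<alpha>)"]
  have "(\<Sum>z\<in>basis Q. \<Prod>\<alpha>\<in>M. F \<alpha> (restrict_bits (pq Q party \<alpha>) z)) =
      (\<Sum>g\<in>?P. \<Prod>\<alpha>\<in>M. F \<alpha> (g \<alpha>))"
    by (simp add: j_def)
  then show ?thesis using finM finQ by (simp add: prod_sum_PiE)
qed

lemma mmul_tensor:
  "mmul Q (tensor_local M Q party U) (tensor_local M Q party V) =
   tensor_local M Q party (\<lambda>\<alpha>. mmul (pq Q party \<alpha>) (U \<alpha>) (V \<alpha>))"
proof (intro ext)
  fix y x
  show "mmul Q (tensor_local M Q party U) (tensor_local M Q party V) y x =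
    tensor_local M Q party (\<lambda>\<alpha>. mmul (pq Q party \<alpha>) (U \<alpha>) (V \<alpha>)) y x"
    unfolding mmul_def tensor_local_def prod.distrib[symmetric]
    by (rule sum_basis_parties)
qed

text \<open>The kernels agree even outside \<open>basis Q\<close>, since \<open>tensor_local\<close>
  evaluates its factors only at restricted strings.\<close>

lemma tensor_cong:
  assumes "\<And>\<alpha>. \<alpha> \<in> M \<Longrightarrow> op_eq (pq Q party \<alpha>) (U \<alpha>) (V \<alpha>)"
  shows "tensor_local M Q party U = tensor_local M Q party V"
  using assms by (auto simp: tensor_local_def fun_eq_iff op_eq_def intro!: prod.cong)

lemma tensor_id: "op_eq Q (tensor_local M Q party (\<lambda>_. id_op)) id_op"
  unfolding op_eq_def
proof (intro ballI)
  fix y x assume yx: "y \<in> basis Q" "x \<in> basis Q"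
  show "tensor_local M Q party (\<lambda>_. id_op) y x = id_op y x"
  proof (cases "y = x")
    case False
    then obtain q where q: "y q \<noteq> x q" by auto
    with yx have "q \<in> Q" by (auto simp: basis_def)
    with q have "restrict_bits (pq Q party (party q)) y \<noteq> restrict_bits (pq Q party (party q)) x"
      by (auto simp: restrict_bits_def pq_def fun_eq_iff)
    moreover have "party q \<in> M" using \<open>q \<in> Q\<close> party by auto
    ultimately have "\<exists>\<alpha>\<in>M. restrict_bits (pq Q party \<alpha>) y \<noteq> restrict_bits (pq Q party \<alpha>) x"
      by blast
    then show ?thesis using False finM by (simp add: tensor_local_def id_op_def)
  qed (simp add: tensor_local_def id_op_def)
qed

lemma adj_tensor: "adj (tensor_local M Q party U) = tensor_local M Q party (\<lambda>\<alpha>. adj (U \<alpha>))"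
  by (simp add: adj_def tensor_local_def fun_eq_iff)

lemma tensor_scale:
  "tensor_local M Q party (\<lambda>\<alpha> y x. s \<alpha> * K \<alpha> y x) =
   (\<lambda>y x. prod s M * tensor_local M Q party K y x)"
  by (simp add: tensor_local_def fun_eq_iff prod.distrib)

lemma pauli_op_tensor:
  "pauli_op Q f =
   tensor_local M Q party (\<lambda>\<alpha>. pauli_op (pq Q party \<alpha>) (restrict_pauli (pq Q party \<alpha>) f))"
proof (intro ext)
  fix y x
  have "pauli_op Q f y x =
      (\<Prod>\<alpha>\<in>M. \<Prod>q\<in>pq Q party \<alpha>. sig1 (fst (f q)) (snd (f q)) (y q) (x q))"
    unfolding pauli_op_def pq_def by (rule prod.group[OF finQ finM party, symmetric])
  also have "\<dots> = tensor_local M Q party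
      (\<lambda>\<alpha>. pauli_op (pq Q party \<alpha>) (restrict_pauli (pq Q party \<alpha>) f)) y x"
    by (simp add: tensor_local_def pauli_op_def restrict_pauli_def restrict_bits_def)
  finally show "pauli_op Q f y x = tensor_local M Q party
      (\<lambda>\<alpha>. pauli_op (pq Q party \<alpha>) (restrict_pauli (pq Q party \<alpha>) f)) y x" .
qed

text \<open>Each party contributes its own sign, and the product over \<open>M\<close> is again a
  sign.\<close>

lemma implements_tensor:
  assumes U: "\<And>\<alpha>. \<alpha> \<in> M \<Longrightarrow> implements (pq Q party \<alpha>) (U \<alpha>) (u \<alpha>)"
  shows "implements Q (tensor_local M Q party U) (local_map Q party u)"
  unfolding implements_def
proof (intro conjI ballI)
  have "tensor_local M Q party (\<lambda>\<alpha>. mmul (pq Q party \<alpha>) (U \<alpha>) (adj (U \<alpha>))) =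
      tensor_local M Q party (\<lambda>_. id_op)"
    "tensor_local M Q party (\<lambda>\<alpha>. mmul (pq Q party \<alpha>) (adj (U \<alpha>)) (U \<alpha>)) =
      tensor_local M Q party (\<lambda>_. id_op)"
    using implementsD(1)[OF U] by (auto intro!: tensor_cong simp: unitary_on_def)
  then show "unitary_on Q (tensor_local M Q party U)"
    by (simp add: unitary_on_def adj_tensor mmul_tensor tensor_id)
  fix f :: "'q pauli" assume "f \<in> Gsp Q"
  let ?R = "\<lambda>\<alpha>. restrict_pauli (pq Q party \<alpha>)"
  have "\<forall>\<alpha>\<in>M. \<exists>s. s \<in> {1, -1} \<and> op_eq (pq Q party \<alpha>)
      (mmul (pq Q party \<alpha>) (U \<alpha>) (pauli_op (pq Q party \<alpha>) (?R \<alpha> f)))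
      (\<lambda>y x. s * mmul (pq Q party \<alpha>) (pauli_op (pq Q party \<alpha>) (u \<alpha> (?R \<alpha> f))) (U \<alpha>) y x)"
    using implementsD(3)[OF U restrict_pauli_Gsp] by blast
  then obtain s where s: "\<And>\<alpha>. \<alpha> \<in> M \<Longrightarrow> s \<alpha> \<in> {1, -1}"
    "\<And>\<alpha>. \<alpha> \<in> M \<Longrightarrow> op_eq (pq Q party \<alpha>)
      (mmul (pq Q party \<alpha>) (U \<alpha>) (pauli_op (pq Q party \<alpha>) (?R \<alpha> f)))
      (\<lambda>y x. s \<alpha> * mmul (pq Q party \<alpha>) (pauli_op (pq Q party \<alpha>) (u \<alpha> (?R \<alpha> f))) (U \<alpha>) y x)"
    by metis
  have "prod s M \<in> {1, -1}"
    using s(1) by (rule prod_signs)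
  moreover have "mmul Q (tensor_local M Q party U) (pauli_op Q f) =
      (\<lambda>y x. prod s M *
        mmul Q (pauli_op Q (local_map Q party u f)) (tensor_local M Q party U) y x)"
  proof -
    have "?R \<alpha> (local_map Q party u f) = u \<alpha> (?R \<alpha> f)" if "\<alpha> \<in> M" for \<alpha>
      using implementsD(2)[OF U[OF that]] by (intro restrict_local_map) auto
    then have "pauli_op Q (local_map Q party u f) =
        tensor_local M Q party (\<lambda>\<alpha>. pauli_op (pq Q party \<alpha>) (u \<alpha> (?R \<alpha> f)))"
      unfolding pauli_op_tensor[of "local_map Q party u f"] by (intro tensor_cong) simp
    then show ?thesis
      using tensor_cong[OF s(2)] by (simp add: pauli_op_tensor[of f] mmul_tensor tensor_scale)
  qed
  ultimately show "\<exists>s\<in>{1, -1}. op_eq Q (mmul Q (tensor_local M Q party U) (pauli_op Q f))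
      (\<lambda>y x. s * mmul Q (pauli_op Q (local_map Q party u f)) (tensor_local M Q party U) y x)"
    by auto
qed (auto simp: Pi_iff)

end

subsection \<open>Stabilizer states\<close>

definition inner :: "'q set \<Rightarrow> 'q state \<Rightarrow> 'q state \<Rightarrow> complex" where
  "inner Q a b = (\<Sum>x\<in>basis Q. cnj (a x) * b x)"

definition stabilizes :: "'q set \<Rightarrow> 'q pauli \<Rightarrow> complex \<Rightarrow> 'q state \<Rightarrow> bool" where
  "stabilizes Q f s \<psi> \<longleftrightarrow> st_eq Q (apply_op Q (pauli_op Q f) \<psi>) (\<lambda>x. s * \<psi> x)"

lemma apply_mmul: "apply_op Q (mmul Q K L) \<psi> = apply_op Q K (apply_op Q L \<psi>)"
proof
  fix y
  have "apply_op Q (mmul Q K L) \<psi> y = (\<Sum>x\<in>basis Q. \<Sum>z\<in>basis Q. K y z * L z x * \<psi> x)"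
    by (simp add: apply_op_def mmul_def sum_distrib_right)
  also have "\<dots> = (\<Sum>z\<in>basis Q. \<Sum>x\<in>basis Q. K y z * L z x * \<psi> x)"
    by (rule sum.swap)
  also have "\<dots> = apply_op Q K (apply_op Q L \<psi>) y"
    by (simp add: apply_op_def sum_distrib_left mult.assoc)
  finally show "apply_op Q (mmul Q K L) \<psi> y = apply_op Q K (apply_op Q L \<psi>) y" .
qed

lemma apply_scale:
  "apply_op Q (\<lambda>y x. s * K y x) \<psi> = (\<lambda>y. s * apply_op Q K \<psi> y)"
  "apply_op Q K (\<lambda>y. s * \<psi> y) = (\<lambda>y. s * apply_op Q K \<psi> y)"
  by (auto simp: apply_op_def fun_eq_iff sum_distrib_left mult.assoc mult.left_commute)

lemma apply_cong: "op_eq Q K L \<Longrightarrow> st_eq Q a b \<Longrightarrow> st_eq Q (apply_op Q K a) (apply_op Q L b)"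
  by (simp add: op_eq_def st_eq_def apply_op_def)

lemma apply_cong_state: "st_eq Q a b \<Longrightarrow> apply_op Q K a = apply_op Q K b"
  by (simp add: st_eq_def apply_op_def fun_eq_iff)

lemma st_eq_refl [simp]: "st_eq Q a a"
  by (simp add: st_eq_def)

lemma st_eq_sym: "st_eq Q a b \<Longrightarrow> st_eq Q b a"
  by (simp add: st_eq_def)

lemma apply_id:
  assumes "finite Q" "op_eq Q K id_op"
  shows "st_eq Q (apply_op Q K \<psi>) \<psi>"
  unfolding st_eq_def
proof
  fix x assume "x \<in> basis Q"
  then have "apply_op Q K \<psi> x = (\<Sum>z\<in>basis Q. if z = x then \<psi> z else 0)"
    unfolding apply_op_def using assms(2) by (intro sum.cong) (auto simp: op_eq_def id_op_def)
  then show "apply_op Q K \<psi> x = \<psi> x" using \<open>x \<in> basis Q\<close> assms(1) by simp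
qed

lemma inner_cong: "st_eq Q a a' \<Longrightarrow> st_eq Q b b' \<Longrightarrow> inner Q a b = inner Q a' b'"
  by (simp add: st_eq_def inner_def)

lemma inner_scale:
  "inner Q (\<lambda>x. s * a x) b = cnj s * inner Q a b" "inner Q a (\<lambda>x. s * b x) = s * inner Q a b"
  by (auto simp: inner_def sum_distrib_left mult.assoc mult.left_commute)

lemma inner_apply: "inner Q (apply_op Q K a) b = inner Q a (apply_op Q (adj K) b)"
proof -
  have "inner Q (apply_op Q K a) b =
      (\<Sum>y\<in>basis Q. \<Sum>x\<in>basis Q. cnj (K y x) * cnj (a x) * b y)"
    by (simp add: inner_def apply_op_def sum_distrib_right)
  also have "\<dots> = (\<Sum>x\<in>basis Q. \<Sum>y\<in>basis Q. cnj (K y x) * cnj (a x) * b y)"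
    by (rule sum.swap)
  also have "\<dots> = inner Q a (apply_op Q (adj K) b)"
    by (simp add: inner_def apply_op_def adj_def sum_distrib_left mult_ac)
  finally show ?thesis .
qed

lemma inner_self: "inner Q a a = of_real (\<Sum>x\<in>basis Q. (cmod (a x))\<^sup>2)"
  by (simp add: inner_def complex_norm_square mult.commute flip: of_real_power)

lemma inner_unitary:
  assumes "finite Q" "unitary_on Q U"
  shows "inner Q (apply_op Q U a) (apply_op Q U b) = inner Q a b"
proof -
  have "st_eq Q (apply_op Q (adj U) (apply_op Q U b)) b"
    using apply_id[OF assms(1), of "mmul Q (adj U) U" b] assms(2)
    by (simp add: unitary_on_def apply_mmul)
  then show ?thesis by (simp add: inner_apply inner_cong[OF st_eq_refl])
qed

lemma self_dualD:
  assumes "self_dual Q S"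
  shows "subspace2 Q S" "f \<in> S \<Longrightarrow> f \<in> Gsp Q" "f \<in> S \<Longrightarrow> g \<in> S \<Longrightarrow> \<not> omega Q f g"
    "f \<in> Gsp Q \<Longrightarrow> (\<And>g. g \<in> S \<Longrightarrow> \<not> omega Q f g) \<Longrightarrow> f \<in> S"
  using assms by (auto simp: self_dual_def sperp_def subspace2_def)

lemma self_dualI:
  assumes "subspace2 Q S" "\<And>f g. f \<in> S \<Longrightarrow> g \<in> S \<Longrightarrow> \<not> omega Q f g"
    "\<And>f. f \<in> Gsp Q \<Longrightarrow> (\<And>g. g \<in> S \<Longrightarrow> \<not> omega Q f g) \<Longrightarrow> f \<in> S"
  shows "self_dual Q S"
  using assms by (auto simp: self_dual_def sperp_def subspace2_def)

lemma stabilizer_stateE: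
  assumes "stabilizer_state Q S \<psi>"
  obtains \<epsilon> where "\<And>f. f \<in> S \<Longrightarrow> \<epsilon> f \<in> {1, -1}" "\<And>f. f \<in> S \<Longrightarrow> stabilizes Q f (\<epsilon> f) \<psi>"
  using assms unfolding stabilizer_state_def stabilizes_def by blast

lemma stabilizer_stateD:
  assumes "stabilizer_state Q S \<psi>"
  shows "self_dual Q S" "inner Q \<psi> \<psi> = 1" "\<exists>x\<in>basis Q. \<psi> x \<noteq> 0"
proof -
  show "self_dual Q S" using assms by (simp add: stabilizer_state_def)
  show n: "inner Q \<psi> \<psi> = 1" using assms by (simp add: stabilizer_state_def inner_self)
  show "\<exists>x\<in>basis Q. \<psi> x \<noteq> 0"
  proof (rule ccontr)
    assume "\<not> ?thesis"
    then have "inner Q \<psi> \<psi> = 0" by (simp add: inner_def)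
    with n show False by simp
  qed
qed

lemma stabilizer_stateI:
  assumes "self_dual Q S" "\<And>x. x \<notin> basis Q \<Longrightarrow> \<psi> x = 0" "inner Q \<psi> \<psi> = 1"
    and "\<And>f. f \<in> S \<Longrightarrow> \<exists>s\<in>{1, -1}. stabilizes Q f s \<psi>"
  shows "stabilizer_state Q S \<psi>"
proof -
  have "\<exists>\<epsilon>. \<forall>f\<in>S. \<epsilon> f \<in> {1, -1} \<and> stabilizes Q f (\<epsilon> f) \<psi>"
    using assms(4) by metis
  moreover have "(\<Sum>x\<in>basis Q. (cmod (\<psi> x))\<^sup>2) = 1"
    using assms(3) unfolding inner_self by (simp only: of_real_eq_1_iff)
  ultimately show ?thesis
    using assms(1,2) by (simp add: stabilizer_state_def stabilizes_def)
qed

lemma stabilizes_twice: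
  assumes f: "stabilizes Q f s \<psi>" and g: "stabilizes Q g t \<psi>"
  shows "st_eq Q (apply_op Q (mmul Q (pauli_op Q f) (pauli_op Q g)) \<psi>) (\<lambda>x. s * t * \<psi> x)"
  using f apply_cong_state[OF g[unfolded stabilizes_def], of "pauli_op Q f"]
  by (simp add: stabilizes_def apply_mmul apply_scale st_eq_def)

text \<open>The consistency rule for eigenvalues. The phase depends on \<open>f\<close> and
  \<open>g\<close> only, so any two sign functions on one group obey the same rule.\<close>

lemma stabilizes_padd:
  assumes Q: "finite Q" and f: "stabilizes Q f s \<psi>" and g: "stabilizes Q g t \<psi>"
    and fg: "stabilizes Q (padd f g) r \<psi>" and nz: "\<exists>x\<in>basis Q. \<psi> x \<noteq> 0"
  shows "pauli_phase Q f g * r = s * t"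
  using stabilizes_twice[OF f g] fg nz
  by (auto simp: stabilizes_def st_eq_def pauli_mmul[OF Q] apply_scale)

text \<open>Anticommuting operators have no common eigenvector with nonzero eigenvalues: applying
  them in both orders gives opposite results.\<close>

lemma stabilizes_commute:
  assumes Q: "finite Q" and f: "stabilizes Q f s \<psi>" and g: "stabilizes Q g t \<psi>"
    and nz: "\<exists>x\<in>basis Q. \<psi> x \<noteq> 0" "s \<noteq> 0" "t \<noteq> 0"
  shows "\<not> omega Q f g"
proof -
  obtain x where x: "x \<in> basis Q" "\<psi> x \<noteq> 0" using nz by blast
  have "s * t * \<psi> x = omega_sign Q f g * (t * s * \<psi> x)"
    using stabilizes_twice[OF f g] stabilizes_twice[OF g f] x nz(2,3)
    by (auto simp: pauli_commute[OF Q, of f g] apply_scale st_eq_def)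
  then show ?thesis using x nz Q by (auto simp: omega_sign_eq split: if_splits)
qed

text \<open>Such an \<open>f\<close> commutes with every stabilizer, hence lies in the symplectic
  complement of \<open>S\<close>, which is \<open>S\<close>. This puts the image of the constructed
  \<open>T\<close> inside \<open>S\<close>.\<close>

lemma stabilizer_state_mem:
  assumes Q: "finite Q" and \<psi>: "stabilizer_state Q S \<psi>" and f: "f \<in> Gsp Q"
    and s: "stabilizes Q f s \<psi>" "s \<noteq> 0"
  shows "f \<in> S"
proof (rule self_dualD(4)[OF stabilizer_stateD(1)[OF \<psi>] f])
  fix g assume g: "g \<in> S"
  obtain \<epsilon> where e: "\<And>f. f \<in> S \<Longrightarrow> \<epsilon> f \<in> {1, -1}" "\<And>f. f \<in> S \<Longrightarrow> stabilizes Q f (\<epsilon> f) \<psi>"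
    using stabilizer_stateE[OF \<psi>] by metis
  have "\<epsilon> g \<noteq> 0" using e(1)[OF g] by auto
  then show "\<not> omega Q f g"
    using stabilizes_commute[OF Q s(1) e(2)[OF g] stabilizer_stateD(3)[OF \<psi>] s(2)] by simp
qed

lemma stabilizes_cong:
  assumes "st_eq Q \<phi> \<psi>" shows "stabilizes Q f s \<phi> \<longleftrightarrow> stabilizes Q f s \<psi>"
  using apply_cong_state[OF assms] assms by (simp add: stabilizes_def st_eq_def)

lemma stabilizes_scale:
  "stabilizes Q f s \<psi> \<Longrightarrow> stabilizes Q f s (\<lambda>x. c * \<psi> x)"
  by (simp add: stabilizes_def apply_scale st_eq_def)

text \<open>Only the intertwining relation enters, so the lemma applies alike to local Cliffords,
  their adjoints and Pauli operators. The sign \<open>t\<close> is its own inverse.\<close>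

lemma stabilizes_intertwine:
  assumes UK: "op_eq Q (mmul Q U (pauli_op Q f)) (\<lambda>y x. t * mmul Q (pauli_op Q g) U y x)"
    and t: "t \<in> {1, -1}" and f: "stabilizes Q f s \<psi>"
  shows "stabilizes Q g (s * t) (apply_op Q U \<psi>)"
proof -
  have "st_eq Q (\<lambda>y. t * apply_op Q (pauli_op Q g) (apply_op Q U \<psi>) y)
      (apply_op Q U (apply_op Q (pauli_op Q f) \<psi>))"
    using st_eq_sym[OF apply_cong[OF UK st_eq_refl[of Q \<psi>]]] by (simp add: apply_scale apply_mmul)
  also have "apply_op Q U (apply_op Q (pauli_op Q f) \<psi>) = (\<lambda>y. s * apply_op Q U \<psi> y)"
    using apply_cong_state[OF f[unfolded stabilizes_def]] by (simp add: apply_scale)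
  finally have eq: "t * apply_op Q (pauli_op Q g) (apply_op Q U \<psi>) y = s * apply_op Q U \<psi> y"
    if "y \<in> basis Q" for y
    using that by (simp add: st_eq_def)
  have tt: "t * (t * a) = a" for a using t by auto
  show ?thesis
    unfolding stabilizes_def st_eq_def
  proof
    fix y assume "y \<in> basis Q"
    from arg_cong[OF eq[OF this], of "\<lambda>a. t * a"]
    show "apply_op Q (pauli_op Q g) (apply_op Q U \<psi>) y = s * t * apply_op Q U \<psi> y"
      by (simp only: tt mult_ac)
  qed
qed

lemma stabilizes_implements:
  assumes "implements Q U u" "f \<in> Gsp Q" "stabilizes Q f s \<psi>" "s \<in> {1, -1}"
  shows "\<exists>t\<in>{1, -1}. stabilizes Q (u f) t (apply_op Q U \<psi>)"
proof -
  obtain t where t: "t \<in> {1, -1}"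
    "op_eq Q (mmul Q U (pauli_op Q f)) (\<lambda>y x. t * mmul Q (pauli_op Q (u f)) U y x)"
    using implementsD(3)[OF assms(1,2)] by blast
  from stabilizes_intertwine[OF t(2,1) assms(3)] show ?thesis
    using t(1) assms(4) by (intro bexI[of _ "s * t"]) auto
qed

lemma adj_scale: "adj (\<lambda>y x. s * K y x) = (\<lambda>y x. cnj s * adj K y x)"
  by (simp add: adj_def fun_eq_iff)

text \<open>The adjoint of the intertwining relation runs \<open>u\<close> backwards without naming
  an inverse map.\<close>

lemma implements_adj:
  assumes Q: "finite Q" and U: "implements Q U u" and f: "f \<in> Gsp Q"
  shows "\<exists>t\<in>{1, -1}. op_eq Q (mmul Q (adj U) (pauli_op Q (u f)))
    (\<lambda>y x. t * mmul Q (pauli_op Q f) (adj U) y x)"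
proof -
  obtain t where t: "t \<in> {1, -1}"
    "op_eq Q (mmul Q U (pauli_op Q f)) (\<lambda>y x. t * mmul Q (pauli_op Q (u f)) U y x)"
    using implementsD(3)[OF U f] by blast
  have ct: "cnj t = t" using t(1) by auto
  from adj_cong[OF t(2)]
  have "op_eq Q (mmul Q (pauli_op Q f) (adj U)) (\<lambda>y x. t * mmul Q (adj U) (pauli_op Q (u f)) y x)"
    by (simp only: adj_mmul adj_scale adj_pauli ct)
  then show ?thesis using t(1) by (intro bexI[of _ t]) (auto simp: op_eq_def)
qed

text \<open>Every element of \<open>S\<close> is some \<open>u h\<close>, so orthogonality to the
  preimage is the same as orthogonality of the image to \<open>S\<close>.\<close>

lemma self_dual_vimage:
  assumes Q: "finite Q" and u: "isometry Q u" and S: "self_dual Q S"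
  shows "self_dual Q {h \<in> Gsp Q. u h \<in> S}"
proof (rule self_dualI)
  note S' = self_dualD[OF S]
  show "subspace2 Q {h \<in> Gsp Q. u h \<in> S}"
    using subspace2D[OF S'(1)] isometry_pzero[OF Q u] isometry_padd[OF Q u]
    by (auto simp: subspace2_def)
  show "\<not> omega Q f g" if "f \<in> {h \<in> Gsp Q. u h \<in> S}" "g \<in> {h \<in> Gsp Q. u h \<in> S}" for f g
    using isometryD(2)[OF u, of f g] S'(3)[of "u f" "u g"] that by auto
  fix f assume f: "f \<in> Gsp Q" "\<And>g. g \<in> {h \<in> Gsp Q. u h \<in> S} \<Longrightarrow> \<not> omega Q f g"
  have "u f \<in> S"
  proof (rule S'(4))
    show "u f \<in> Gsp Q" using isometryD(1)[OF u f(1)] .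
    fix g assume g: "g \<in> S"
    then obtain h where h: "h \<in> Gsp Q" "g = u h"
      using isometry_bij[OF Q u] S'(2)[OF g] by (auto simp: bij_betw_def)
    then show "\<not> omega Q (u f) g" using isometryD(2)[OF u f(1) h(1)] f(2)[of h] g by simp
  qed
  then show "f \<in> {h \<in> Gsp Q. u h \<in> S}" using f by simp
qed

section \<open>Completeness of the Pauli basis and the stabilizer projector\<close>

lemma sig1_complete:
  "(\<Sum>p\<in>UNIV. sig1 (fst p) (snd p) y x * cnj (sig1 (fst p) (snd p) v w)) =
   (if y = v \<and> x = w then 2 else 0)"
  by (auto simp: UNIV_Times_UNIV[symmetric] sum.cartesian_product'[symmetric] UNIV_bool sig1_def
      simp del: UNIV_Times_UNIV)

text \<open>The four matrices \<sigma>_p / sqrt 2 form an orthonormal basis of the 2 by 2 matrices;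
  this is the resulting completeness relation, multiplied over the qubits.\<close>

lemma pauli_complete:
  assumes Q: "finite Q" and "y \<in> basis Q" "x \<in> basis Q" "v \<in> basis Q" "w \<in> basis Q"
  shows "(\<Sum>g\<in>Gsp Q. pauli_op Q g y x * cnj (pauli_op Q g v w)) =
    (if y = v \<and> x = w then 2 ^ card Q else 0)"
proof -
  have "(\<Sum>g\<in>Gsp Q. pauli_op Q g y x * cnj (pauli_op Q g v w)) =
      (\<Sum>g\<in>Gsp Q. \<Prod>q\<in>Q. sig1 (fst (g q)) (snd (g q)) (y q) (x q) *
        cnj (sig1 (fst (g q)) (snd (g q)) (v q) (w q)))"
    by (simp add: pauli_op_def prod.distrib)
  also have "\<dots> = (\<Prod>q\<in>Q. \<Sum>p\<in>UNIV. sig1 (fst p) (snd p) (y q) (x q) *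
        cnj (sig1 (fst p) (snd p) (v q) (w q)))"
    using Q by (rule sum_prod_Gsp)
  also have "\<dots> = (\<Prod>q\<in>Q. if y q = v q \<and> x q = w q then 2 else 0)"
    by (simp only: sig1_complete)
  also have "\<dots> = (if y = v \<and> x = w then 2 ^ card Q else 0)"
  proof (cases "y = v \<and> x = w")
    case False
    then obtain q where "y q \<noteq> v q \<or> x q \<noteq> w q" by auto
    moreover from this have "q \<in> Q" using assms by (auto simp: basis_def)
    ultimately show ?thesis using Q False by (auto intro!: prod_zero)
  qed simp
  finally show ?thesis .
qed

text \<open>Expanding \<open>|\<psi>\<rangle>\<langle>\<psi>|\<close> in the Pauli basis, the coefficient at \<open>g \<notin> S\<close> vanishes because \<open>\<sigma>(g)\<close>
  anticommutes with some stabilizer.\<close>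

lemma stabilizer_projector:
  assumes Q: "finite Q" and \<psi>: "stabilizer_state Q S \<psi>"
    and \<epsilon>: "\<And>f. f \<in> S \<Longrightarrow> \<epsilon> f \<in> {1, -1}" "\<And>f. f \<in> S \<Longrightarrow> stabilizes Q f (\<epsilon> f) \<psi>"
    and y: "y \<in> basis Q" and v: "v \<in> basis Q"
  shows "2 ^ card Q * (\<psi> y * cnj (\<psi> v)) = (\<Sum>f\<in>S. \<epsilon> f * pauli_op Q f y v)"
proof -
  define c where "c g = inner Q (apply_op Q (pauli_op Q g) \<psi>) \<psi>" for g
  note S = self_dualD[OF stabilizer_stateD(1)[OF \<psi>]]
  have c_in: "c g = \<epsilon> g" if "g \<in> S" for g
  proof -
    have "c g = cnj (\<epsilon> g)"
      using inner_cong[OF \<epsilon>(2)[OF that, unfolded stabilizes_def] st_eq_refl[of Q \<psi>]]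
        stabilizer_stateD(2)[OF \<psi>] by (simp add: c_def inner_scale)
    then show ?thesis using \<epsilon>(1)[OF that] by auto
  qed
  have c_out: "c g = 0" if g: "g \<in> Gsp Q" "g \<notin> S" for g
  proof -
    obtain f where f: "f \<in> S" "omega Q g f" using S(4)[OF g(1)] g(2) by blast
    let ?f = "pauli_op Q f" and ?g = "pauli_op Q g"
    have ef: "\<epsilon> f * \<epsilon> f = 1" "cnj (\<epsilon> f) = \<epsilon> f" using \<epsilon>(1)[OF f(1)] by auto
    have st: "st_eq Q (apply_op Q ?f \<psi>) (\<lambda>x. \<epsilon> f * \<psi> x)"
      using \<epsilon>(2)[OF f(1)] by (simp add: stabilizes_def)
    \<comment> \<open>The stabilizer \<sigma>(f) is created from \<psi> in one slot, moved across
      \<sigma>(g) at the cost of a sign, and absorbed by \<psi> in the other slot.\<close>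
    have "\<epsilon> f * c g = inner Q (apply_op Q ?g \<psi>) (apply_op Q ?f \<psi>)"
      using inner_cong[OF st_eq_refl st] by (simp add: c_def inner_scale)
    also have "\<dots> = inner Q (apply_op Q (mmul Q ?f ?g) \<psi>) \<psi>"
      by (simp add: inner_apply apply_mmul)
    also have "mmul Q ?f ?g = (\<lambda>y x. - 1 * mmul Q ?g ?f y x)"
      using pauli_commute[OF Q, of f g] f(2) Q by (simp add: omega_sign_eq omega_sym[of Q f g])
    also have "inner Q (apply_op Q (\<lambda>y x. - 1 * mmul Q ?g ?f y x) \<psi>) \<psi> =
        - inner Q (apply_op Q ?g (apply_op Q ?f \<psi>)) \<psi>"
      unfolding apply_scale apply_mmul inner_scale by simp
    also have "\<dots> = - (\<epsilon> f * c g)"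
      using apply_cong_state[OF st, of ?g] ef by (simp add: apply_scale inner_scale c_def)
    finally show ?thesis using ef by auto
  qed
  \<comment> \<open>Written in this form, \<open>pauli_complete\<close> will select the single term
    w = y, x = v.\<close>
  have c_sum: "c g = (\<Sum>w\<in>basis Q. \<Sum>x\<in>basis Q. cnj (pauli_op Q g w x) * (\<psi> w * cnj (\<psi> x)))" for g
    by (simp add: c_def inner_def apply_op_def sum_distrib_right sum_distrib_left mult_ac)
  have "(\<Sum>f\<in>S. \<epsilon> f * pauli_op Q f y v) = (\<Sum>g\<in>Gsp Q. c g * pauli_op Q g y v)"
    using c_in c_out S(2) Q by (intro sum.mono_neutral_cong_left) auto
  also have "\<dots> = (\<Sum>g\<in>Gsp Q. \<Sum>w\<in>basis Q. \<Sum>x\<in>basis Q.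
      pauli_op Q g y v * cnj (pauli_op Q g w x) * (\<psi> w * cnj (\<psi> x)))"
    by (simp add: c_sum sum_distrib_left sum_distrib_right mult_ac)
  also have "\<dots> = (\<Sum>w\<in>basis Q. \<Sum>g\<in>Gsp Q. \<Sum>x\<in>basis Q.
      pauli_op Q g y v * cnj (pauli_op Q g w x) * (\<psi> w * cnj (\<psi> x)))"
    by (rule sum.swap)
  also have "\<dots> = (\<Sum>w\<in>basis Q. \<Sum>x\<in>basis Q.
      (\<Sum>g\<in>Gsp Q. pauli_op Q g y v * cnj (pauli_op Q g w x)) * (\<psi> w * cnj (\<psi> x)))"
    unfolding sum_distrib_right by (intro sum.cong refl sum.swap)
  also have "\<dots> = (\<Sum>w\<in>basis Q. \<Sum>x\<in>basis Q.
      if w = y then if x = v then 2 ^ card Q * (\<psi> w * cnj (\<psi> x)) else 0 else 0)"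
    using pauli_complete[OF Q y v] by (intro sum.cong) auto
  also have "\<dots> = (\<Sum>w\<in>basis Q. if w = y then 2 ^ card Q * (\<psi> w * cnj (\<psi> v)) else 0)"
    using Q v by (intro sum.cong) auto
  also have "\<dots> = 2 ^ card Q * (\<psi> y * cnj (\<psi> v))"
    using Q y by simp
  finally show ?thesis by simp
qed

subsection \<open>Embedding a subsystem\<close>

text \<open>Polymorphic in the values, so that one operation joins both Pauli vectors and bit
  strings of the two subsystems.\<close>

definition glue :: "('q \<Rightarrow> 'p) \<Rightarrow> 'q set \<Rightarrow> ('q \<Rightarrow> 'v) \<Rightarrow> ('p \<Rightarrow> 'v) \<Rightarrow> 'p \<Rightarrow> 'v" where
  "glue e Q' f h p = (if p \<in> e ` Q' then f (inv_into Q' e p) else h p)"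

locale embedding =
  fixes e :: "'q \<Rightarrow> 'p" and Q' :: "'q set" and Q :: "'p set"
  assumes finQ: "finite Q" and finQ': "finite Q'" and inj: "inj_on e Q'" and sub: "e ` Q' \<subseteq> Q"
begin

abbreviation R :: "'p set" where "R \<equiv> Q - e ` Q'"

abbreviation pull :: "'p bits \<Rightarrow> 'q bits" where "pull x \<equiv> (\<lambda>q. q \<in> Q' \<and> x (e q))"

lemma glue_in [simp]: "q \<in> Q' \<Longrightarrow> glue e Q' f h (e q) = f q"
  using inj by (simp add: glue_def)

lemma glue_out [simp]: "p \<notin> e ` Q' \<Longrightarrow> glue e Q' f h p = h p"
  by (simp add: glue_def)

lemma glue_Gsp: "h \<in> Gsp R \<Longrightarrow> glue e Q' f h \<in> Gsp Q"
  using sub by (auto simp: Gsp_def glue_def)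

lemma glue_basis: "z \<in> basis R \<Longrightarrow> glue e Q' x z \<in> basis Q"
  using sub by (auto simp: basis_def glue_def)

lemma glue_padd: "padd (glue e Q' f h) (glue e Q' f' h') = glue e Q' (padd f f') (padd h h')"
  by (simp add: glue_def padd_def fun_eq_iff)

lemma glue_pzero: "glue e Q' pzero pzero = pzero"
  by (simp add: glue_def pzero_def fun_eq_iff)

lemma pull_glue [simp]:
  assumes "x \<in> basis Q'"
  shows "pull (glue e Q' x z) = x"
proof
  fix q
  from assms show "pull (glue e Q' x z) q = x q" by (cases "q \<in> Q'") (auto simp: basis_def)
qed

lemma glue_pull [simp]:
  "z \<in> basis R \<Longrightarrow> restrict_bits R (glue e Q' x z) = z"
  "w \<in> basis Q \<Longrightarrow> glue e Q' (pull w) (restrict_bits R w) = w"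
  using inj by (auto simp: fun_eq_iff basis_def restrict_bits_def glue_def)

lemma pull_basis [simp]: "pull x \<in> basis Q'" "restrict_bits R x \<in> basis R"
  by (auto simp: basis_def restrict_bits_def)

lemma Gsp_glue:
  assumes "r \<in> Gsp Q"
  obtains f h where "f \<in> Gsp Q'" "h \<in> Gsp R" "r = glue e Q' f h"
proof
  show "(\<lambda>q. if q \<in> Q' then r (e q) else (False, False)) \<in> Gsp Q'" by (simp add: Gsp_def)
  show "restrict_pauli R r \<in> Gsp R" by simp
  show "r = glue e Q' (\<lambda>q. if q \<in> Q' then r (e q) else (False, False)) (restrict_pauli R r)"
    using assms inj by (auto simp: fun_eq_iff Gsp_def restrict_pauli_def glue_def)
qed

lemma sum_glue:
  "(\<Sum>x\<in>basis Q. F x) = (\<Sum>x\<in>basis Q'. \<Sum>z\<in>basis R. F (glue e Q' x z) :: complex)"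
proof -
  have "bij_betw (\<lambda>(x, z). glue e Q' x z) (basis Q' \<times> basis R) (basis Q)"
    by (rule bij_betwI[where g = "\<lambda>x. (pull x, restrict_bits R x)"])
      (auto simp del: Diff_iff intro: glue_basis)
  from sum.reindex_bij_betw[OF this, of F] show ?thesis
    by (simp add: sum.cartesian_product case_prod_unfold)
qed

text \<open>A general \<open>A\<close> is allowed because the splitting is applied to the qubits of
  a single party as well as to all of \<open>Q\<close>.\<close>

lemma prod_glue:
  assumes "finite A" "B \<subseteq> Q'" "e ` B = A \<inter> e ` Q'"
  shows "(\<Prod>p\<in>A. F p) = (\<Prod>q\<in>B. F (e q)) * (\<Prod>p\<in>A - e ` Q'. F p :: complex)"
proof -
  have "(\<Prod>p\<in>A. F p) = (\<Prod>p\<in>A \<inter> e ` Q'. F p) * (\<Prod>p\<in>A - e ` Q'. F p)"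
    using assms(1) by (rule prod.Int_Diff)
  also have "(\<Prod>p\<in>A \<inter> e ` Q'. F p) = (\<Prod>q\<in>B. F (e q))"
    unfolding assms(3)[symmetric] using inj_on_subset[OF inj assms(2)] by (simp add: prod.reindex)
  finally show ?thesis .
qed

lemma prod_glue_all: "(\<Prod>p\<in>Q. F p) = (\<Prod>q\<in>Q'. F (e q)) * (\<Prod>p\<in>R. F p :: complex)"
  using sub finQ by (intro prod_glue) auto

lemma pauli_glue:
  "pauli_op Q (glue e Q' f h) (glue e Q' y z) (glue e Q' x w) = pauli_op Q' f y x * pauli_op R h z w"
  by (simp add: pauli_op_def prod_glue_all)

lemma pauli_phase_glue:
  "pauli_phase Q (glue e Q' f h) (glue e Q' f' h') = pauli_phase Q' f f' * pauli_phase R h h'"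
  by (simp add: pauli_phase_def prod_glue_all)

lemma omega_glue:
  assumes "finite A" "B \<subseteq> Q'" "e ` B = A \<inter> e ` Q'"
  shows "omega A (glue e Q' f h) (glue e Q' f' h') \<longleftrightarrow>
    omega B f f' \<noteq> omega (A - e ` Q') h h'"
proof -
  have "finite B" using finQ' assms(2) finite_subset by blast
  have "omega_sign A (glue e Q' f h) (glue e Q' f' h') =
      omega_sign B f f' * omega_sign (A - e ` Q') h h'"
    unfolding omega_sign_def prod_glue[OF assms]
    using assms(2) by (intro arg_cong2[where f = "(*)"] prod.cong) auto
  then show ?thesis using \<open>finite B\<close> assms(1) by (auto simp: omega_sign_eq split: if_splits)
qed

lemma omega_glue_all:
  "omega Q (glue e Q' f h) (glue e Q' f' h') \<longleftrightarrow> omega Q' f f' \<noteq> omega R h h'"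
  using sub finQ by (intro omega_glue) auto

lemma apply_glue:
  "apply_op Q (pauli_op Q (glue e Q' f h)) \<Phi> (glue e Q' y z) =
   (\<Sum>x\<in>basis Q'. \<Sum>w\<in>basis R. pauli_op Q' f y x * pauli_op R h z w * \<Phi> (glue e Q' x w))"
  by (simp add: apply_op_def sum_glue pauli_glue)

lemma st_eq_glueI:
  assumes "\<And>y z. y \<in> basis Q' \<Longrightarrow> z \<in> basis R \<Longrightarrow> \<phi> (glue e Q' y z) = \<psi> (glue e Q' y z)"
  shows "st_eq Q \<phi> \<psi>"
  unfolding st_eq_def
proof
  fix x assume "x \<in> basis Q"
  then show "\<phi> x = \<psi> x" using assms[OF pull_basis, of x x] by simp
qed

lemma inner_product_state:
  assumes "\<And>y z. y \<in> basis Q' \<Longrightarrow> z \<in> basis R \<Longrightarrow> \<Phi> (glue e Q' y z) = \<phi> y * \<chi> z"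
  shows "inner Q \<Phi> \<Phi> = inner Q' \<phi> \<phi> * inner R \<chi> \<chi>"
  using assms by (simp add: inner_def sum_glue sum_product mult_ac)

lemma apply_product_state:
  assumes "\<And>y z. y \<in> basis Q' \<Longrightarrow> z \<in> basis R \<Longrightarrow> \<Phi> (glue e Q' y z) = \<phi> y * \<chi> z"
  shows "apply_op Q (pauli_op Q (glue e Q' f h)) \<Phi> (glue e Q' y z) =
    apply_op Q' (pauli_op Q' f) \<phi> y * apply_op R (pauli_op R h) \<chi> z"
  unfolding apply_glue unfolding apply_op_def by (simp add: assms sum_product mult_ac)

lemma apply_pzero:
  assumes "finite A" "y \<in> basis A"
  shows "apply_op A (pauli_op A pzero) \<phi> y = \<phi> y"
  using apply_id[OF assms(1) pauli_op_pzero[OF assms(1)], of \<phi>] assms(2) by (simp add: st_eq_def)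

lemma apply_glue_left:
  assumes z: "z \<in> basis R"
  shows "apply_op Q (pauli_op Q (glue e Q' f pzero)) \<Phi> (glue e Q' y z) =
    (\<Sum>x\<in>basis Q'. pauli_op Q' f y x * \<Phi> (glue e Q' x z))"
proof -
  have "apply_op Q (pauli_op Q (glue e Q' f pzero)) \<Phi> (glue e Q' y z) =
      (\<Sum>x\<in>basis Q'. pauli_op Q' f y x * apply_op R (pauli_op R pzero) (\<lambda>w. \<Phi> (glue e Q' x w)) z)"
    unfolding apply_glue by (simp add: apply_op_def sum_distrib_left mult.assoc)
  then show ?thesis using apply_pzero[OF _ z] finQ by simp
qed

lemma stabilizes_left_product:
  assumes "\<And>y z. y \<in> basis Q' \<Longrightarrow> z \<in> basis R \<Longrightarrow> \<Phi> (glue e Q' y z) = \<phi> y * \<chi> z"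
    and "stabilizes Q' f s \<phi>"
  shows "stabilizes Q (glue e Q' f pzero) s \<Phi>"
  unfolding stabilizes_def
proof (rule st_eq_glueI)
  fix y z assume "y \<in> basis Q'" "z \<in> basis R"
  then show "apply_op Q (pauli_op Q (glue e Q' f pzero)) \<Phi> (glue e Q' y z) = s * \<Phi> (glue e Q' y z)"
    using assms finQ by (simp add: apply_product_state[of \<Phi> \<phi> \<chi>, OF assms(1)] apply_pzero stabilizes_def st_eq_def)
qed

text \<open>The operator acts on the second factor alone, so its eigenvalue equation may be divided
  by a nonzero amplitude of \<phi>.\<close>

lemma stabilizes_right_factor:
  assumes \<Phi>: "\<And>y z. y \<in> basis Q' \<Longrightarrow> z \<in> basis R \<Longrightarrow> \<Phi> (glue e Q' y z) = \<phi> y * \<chi> z"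
    and h: "stabilizes Q (glue e Q' pzero h) s \<Phi>" and nz: "\<exists>y\<in>basis Q'. \<phi> y \<noteq> 0"
  shows "stabilizes R h s \<chi>"
  unfolding stabilizes_def st_eq_def
proof
  fix z assume z: "z \<in> basis R"
  obtain y where y: "y \<in> basis Q'" "\<phi> y \<noteq> 0" using nz by blast
  have "apply_op Q (pauli_op Q (glue e Q' pzero h)) \<Phi> (glue e Q' y z) = s * \<Phi> (glue e Q' y z)"
    using h glue_basis[OF z] by (simp add: stabilizes_def st_eq_def)
  then have "\<phi> y * apply_op R (pauli_op R h) \<chi> z = s * (\<phi> y * \<chi> z)"
    using y z finQ' by (simp add: apply_product_state[of \<Phi> \<phi> \<chi>, OF \<Phi>] apply_pzero \<Phi>)
  with y show "apply_op R (pauli_op R h) \<chi> z = s * \<chi> z" by (simp add: mult.left_commute)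
qed

text \<open>Summing the signed stabilizers gives 2^k |\<psi>'><\<psi>'|, with k the size of
  \<open>Q'\<close>, but acts on \<Phi> as the number \<open>card S'\<close>. So for each
  \<open>z\<close> the slice of \<Phi> is a multiple of \<psi>', with coefficient a partial inner
  product.\<close>

lemma factorization:
  assumes \<psi>': "stabilizer_state Q' S' \<psi>'"
    and \<epsilon>: "\<And>f. f \<in> S' \<Longrightarrow> \<epsilon> f \<in> {1, -1}" "\<And>f. f \<in> S' \<Longrightarrow> stabilizes Q' f (\<epsilon> f) \<psi>'"
    and \<Phi>: "\<And>f. f \<in> S' \<Longrightarrow> stabilizes Q (glue e Q' f pzero) (\<epsilon> f) \<Phi>"
  obtains \<psi>'' where "\<And>z. z \<notin> basis R \<Longrightarrow> \<psi>'' z = 0"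
    "\<And>y z. y \<in> basis Q' \<Longrightarrow> z \<in> basis R \<Longrightarrow> \<Phi> (glue e Q' y z) = \<psi>' y * \<psi>'' z"
proof
  \<comment> \<open>A self-dual group on k qubits has 2^k elements, so this constant is really 1;
    keeping the quotient avoids proving that count.\<close>
  let ?c = "2 ^ card Q' / of_nat (card S') :: complex"
  let ?\<psi> = "\<lambda>z. if z \<in> basis R then ?c * (\<Sum>v\<in>basis Q'. cnj (\<psi>' v) * \<Phi> (glue e Q' v z)) else 0"
  show "?\<psi> z = 0" if "z \<notin> basis R" for z using that by simp
  fix y z assume y: "y \<in> basis Q'" and z: "z \<in> basis R"
  have sub': "subspace2 Q' S'" using self_dualD(1)[OF stabilizer_stateD(1)[OF \<psi>']] .
  have "finite S'" using finite_subset[OF subspace2D(1)[OF sub'] finite_Gsp[OF finQ']] .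
  then have S': "card S' \<noteq> 0" using subspace2D(2)[OF sub'] by auto
  have "2 ^ card Q' * (\<psi>' y * (\<Sum>v\<in>basis Q'. cnj (\<psi>' v) * \<Phi> (glue e Q' v z))) =
      (\<Sum>v\<in>basis Q'. (2 ^ card Q' * (\<psi>' y * cnj (\<psi>' v))) * \<Phi> (glue e Q' v z))"
    by (simp add: sum_distrib_left mult.assoc)
  also have "\<dots> = (\<Sum>v\<in>basis Q'. \<Sum>f\<in>S'. \<epsilon> f * (pauli_op Q' f y v * \<Phi> (glue e Q' v z)))"
    by (intro sum.cong refl)
      (simp add: stabilizer_projector[OF finQ' \<psi>' \<epsilon> y] sum_distrib_right mult.assoc)
  also have "\<dots> = (\<Sum>f\<in>S'. \<epsilon> f * (\<Sum>v\<in>basis Q'. pauli_op Q' f y v * \<Phi> (glue e Q' v z)))"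
    unfolding sum_distrib_left by (rule sum.swap)
  also have "\<dots> = (\<Sum>f\<in>S'. \<epsilon> f * (\<epsilon> f * \<Phi> (glue e Q' y z)))"
    using \<Phi> glue_basis[OF z]
    by (intro sum.cong refl) (simp add: apply_glue_left[OF z, symmetric] stabilizes_def st_eq_def)
  also have "\<dots> = (\<Sum>f\<in>S'. \<Phi> (glue e Q' y z))"
    using \<epsilon>(1) by (intro sum.cong refl) fastforce
  also have "\<dots> = of_nat (card S') * \<Phi> (glue e Q' y z)"
    by simp
  finally show "\<Phi> (glue e Q' y z) = \<psi>' y * ?\<psi> z"
    using S' z by (simp add: field_simps)
qed

text \<open>\<open>W\<close> is the direct sum of the embedded \<open>S'\<close> and the part
  supported on \<open>R\<close>. For r = (f,k) in \<open>W\<close>, \<open>f\<close> is orthogonal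
  to \<open>S'\<close>, hence in \<open>S'\<close>; adding its embedding leaves (0,k) in
  \<open>W\<close>. So a vector on \<open>R\<close> orthogonal to that part is orthogonal to all of
  \<open>W\<close>.\<close>

lemma self_dual_complement:
  assumes S': "self_dual Q' S'" and W: "self_dual Q W" and S'W: "\<And>f. f \<in> S' \<Longrightarrow> glue e Q' f pzero \<in> W"
  shows "self_dual R {h \<in> Gsp R. glue e Q' pzero h \<in> W}" (is "self_dual R ?S")
proof (rule self_dualI)
  note S' = self_dualD[OF S'] and W = self_dualD[OF W]
  show "subspace2 R ?S"
    using subspace2D[OF W(1)] glue_padd[of pzero _ pzero]
    by (auto simp: subspace2_def glue_pzero) (metis padd_simps(1))
  show "\<not> omega R f g" if "f \<in> ?S" "g \<in> ?S" for f g
    using W(3)[of "glue e Q' pzero f" "glue e Q' pzero g"] that by (simp add: omega_glue_all)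
  fix h assume h: "h \<in> Gsp R" "\<And>g. g \<in> ?S \<Longrightarrow> \<not> omega R h g"
  have "glue e Q' pzero h \<in> W"
  proof (rule W(4)[OF glue_Gsp[OF h(1)]])
    fix r assume r: "r \<in> W"
    obtain f k where fk: "f \<in> Gsp Q'" "k \<in> Gsp R" "r = glue e Q' f k"
      using Gsp_glue W(2)[OF r] by metis
    have "f \<in> S'"
    proof (rule S'(4)[OF fk(1)])
      fix g assume "g \<in> S'"
      then show "\<not> omega Q' f g"
        using W(3)[OF r S'W] by (simp add: fk omega_glue_all)
    qed
    then have "padd r (glue e Q' f pzero) \<in> W" using subspace2D(3)[OF W(1) r S'W] by blast
    then have "k \<in> ?S" using fk(2) by (simp add: fk(3) glue_padd)
    then show "\<not> omega Q (glue e Q' pzero h) r"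
      using h(2) by (simp add: fk(3) omega_glue_all)
  qed
  with h show "h \<in> ?S" by simp
qed

end

subsection \<open>Extractability\<close>

text \<open>Both sides are images under \<open>T\<close> of subsets of \<open>S'\<close>, so
  injectivity cancels \<open>T\<close> and leaves a condition on each \<open>f\<close>
  separately.\<close>

lemma colocal_image_iff:
  assumes "inj_on T S'"
  shows "colocal Q party \<alpha> (T ` S') = T ` colocal Q' party' \<alpha> S' \<longleftrightarrow>
    (\<forall>f\<in>S'. (\<forall>q\<in>pq Q party \<alpha>. T f q = (False, False)) \<longleftrightarrow>
      (\<forall>q\<in>pq Q' party' \<alpha>. f q = (False, False)))"
proof -
  have "colocal Q party \<alpha> (T ` S') = T ` {f \<in> S'. \<forall>q\<in>pq Q party \<alpha>. T f q = (False, False)}"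
    by (auto simp: colocal_def)
  moreover have "colocal Q' party' \<alpha> S' \<subseteq> S'" by (auto simp: colocal_def)
  ultimately have "colocal Q party \<alpha> (T ` S') = T ` colocal Q' party' \<alpha> S' \<longleftrightarrow>
      {f \<in> S'. \<forall>q\<in>pq Q party \<alpha>. T f q = (False, False)} = colocal Q' party' \<alpha> S'"
    using inj_on_image_eq_iff[OF assms, of "{f \<in> S'. \<forall>q\<in>pq Q party \<alpha>. T f q = (False, False)}"
        "colocal Q' party' \<alpha> S'"] by auto
  then show ?thesis by (auto simp: colocal_def)
qed

locale party_embedding = parties M Q party + embedding e Q' Q
  for M :: "'m set" and Q :: "'p set" and party :: "'p \<Rightarrow> 'm" and e :: "'q \<Rightarrow> 'p" and Q' :: "'q set" +
  fixes party' :: "'q \<Rightarrow> 'm"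
  assumes party_e: "\<And>q. q \<in> Q' \<Longrightarrow> party (e q) = party' q"
begin

abbreviation embed :: "'q pauli \<Rightarrow> 'p pauli" where "embed f \<equiv> glue e Q' f pzero"

abbreviation loc :: "'m \<Rightarrow> 'p pauli \<Rightarrow> 'p pauli" where "loc \<alpha> \<equiv> restrict_pauli (pq Q party \<alpha>)"

lemma embed_Gsp [simp]: "embed f \<in> Gsp Q"
  by (rule glue_Gsp) simp

lemma embed_padd: "embed (padd f g) = padd (embed f) (embed g)"
  by (simp add: glue_padd)

lemma embed_inj: "f \<in> Gsp Q' \<Longrightarrow> g \<in> Gsp Q' \<Longrightarrow> embed f = embed g \<Longrightarrow> f = g"
proof
  fix q assume *: "f \<in> Gsp Q'" "g \<in> Gsp Q'" "embed f = embed g"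
  show "f q = g q"
    using fun_cong[OF *(3), of "e q"] *(1,2) by (cases "q \<in> Q'") (auto simp: Gsp_def)
qed

lemma image_pq: "e ` pq Q' party' \<alpha> = pq Q party \<alpha> \<inter> e ` Q'"
  using sub party_e by (auto simp: pq_def)

lemma omega_embed: "omega (pq Q party \<alpha>) (embed f) (embed g) = omega (pq Q' party' \<alpha>) f g"
  using omega_glue[OF _ _ image_pq, of \<alpha> f pzero g pzero] finQ by (auto simp: pq_def)

lemma loc_embed_eq_pzero:
  "loc \<alpha> (embed f) = pzero \<longleftrightarrow> (\<forall>q\<in>pq Q' party' \<alpha>. f q = (False, False))"
proof -
  have "loc \<alpha> (embed f) = pzero \<longleftrightarrow> (\<forall>p\<in>pq Q party \<alpha> \<inter> e ` Q'. embed f p = (False, False))"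
    unfolding restrict_pauli_eq_pzero by (auto simp: glue_def pzero_def)
  also have "\<dots> \<longleftrightarrow> (\<forall>q\<in>pq Q' party' \<alpha>. f q = (False, False))"
    unfolding image_pq[symmetric] by (auto simp: pq_def)
  finally show ?thesis .
qed

text \<open>\<open>T\<close> is the embedding followed by the isometry of the local Cliffords. Its
  range lies in \<open>S\<close> because \<psi> is an eigenvector of each \<sigma>(T f); both local
  conditions hold because each \<open>u \<alpha>\<close> is an injective isometry.\<close>

lemma forward:
  assumes \<psi>: "stabilizer_state Q S \<psi>" and \<psi>': "stabilizer_state Q' S' \<psi>'"
    and U: "\<And>\<alpha>. \<alpha> \<in> M \<Longrightarrow> clifford (pq Q party \<alpha>) (U \<alpha>)"
    and eq: "st_eq Q \<psi> (\<lambda>y. c * apply_op Q (tensor_local M Q party U)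
        (\<lambda>x. \<psi>' (pull x) * \<psi>'' (restrict_bits R x)) y)"
  shows "\<exists>T. (\<forall>f\<in>S'. T f \<in> S) \<and> (\<forall>f\<in>S'. \<forall>g\<in>S'. T (padd f g) = padd (T f) (T g)) \<and> inj_on T S' \<and>
       (\<forall>f\<in>S'. \<forall>g\<in>S'. \<forall>\<alpha>\<in>M.
          omega (pq Q party \<alpha>) (T f) (T g) = omega (pq Q' party' \<alpha>) f g) \<and>
       (\<forall>\<alpha>\<in>M. colocal Q party \<alpha> (T ` S') = T ` (colocal Q' party' \<alpha> S'))"
proof -
  let ?V = "tensor_local M Q party U"
  have "\<forall>\<alpha>\<in>M. \<exists>u. implements (pq Q party \<alpha>) (U \<alpha>) u"
    using U finQ by (simp add: clifford_iff_implements)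
  then obtain u where u: "\<And>\<alpha>. \<alpha> \<in> M \<Longrightarrow> implements (pq Q party \<alpha>) (U \<alpha>) (u \<alpha>)"
    by metis
  have V: "implements Q ?V (local_map Q party u)" using u by (rule implements_tensor)
  have isoV: "isometry Q (local_map Q party u)" using implements_isometry[OF finQ V] .
  have iso: "isometry (pq Q party \<alpha>) (u \<alpha>)" if "\<alpha> \<in> M" for \<alpha>
    using implements_isometry[OF _ u[OF that]] finQ by simp
  define T where "T f = local_map Q party u (embed f)" for f
  have locT: "loc \<alpha> (T f) = u \<alpha> (loc \<alpha> (embed f))" if "\<alpha> \<in> M" for \<alpha> f
    using iso[OF that] unfolding T_def by (intro restrict_local_map) (simp add: isometry_def)
  have "T f \<in> S" if f: "f \<in> S'" for f
  proof -
    obtain s where s: "s \<in> {1, -1}" "stabilizes Q' f s \<psi>'"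
      using stabilizer_stateE[OF \<psi>'] f by metis
    have "stabilizes Q (embed f) s (\<lambda>x. \<psi>' (pull x) * \<psi>'' (restrict_bits R x))"
      using s(2) by (intro stabilizes_left_product[where \<phi> = \<psi>' and \<chi> = \<psi>'']) simp_all
    from stabilizes_implements[OF V embed_Gsp this s(1)]
    obtain t where t: "t \<in> {1, -1}" "stabilizes Q (T f) t \<psi>"
      using stabilizes_scale[of Q _ _ _ c] stabilizes_cong[OF eq] unfolding T_def by blast
    moreover have "t \<noteq> 0" using t(1) by auto
    ultimately show ?thesis
      using stabilizer_state_mem[OF finQ \<psi>, of "T f" t] by (simp add: T_def)
  qed
  moreover have "T (padd f g) = padd (T f) (T g)" for f g
    unfolding T_def embed_padd by (simp add: isometry_padd[OF finQ isoV])
  moreover have injT: "inj_on T S'"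
  proof (rule inj_onI)
    fix f g assume fg: "f \<in> S'" "g \<in> S'" "T f = T g"
    then have "embed f = embed g"
      using isometry_bij[OF finQ isoV] by (auto simp: T_def bij_betw_def dest: inj_onD)
    then show "f = g"
      using fg self_dualD(2)[OF stabilizer_stateD(1)[OF \<psi>']] by (intro embed_inj)
  qed
  moreover have "omega (pq Q party \<alpha>) (T f) (T g) = omega (pq Q' party' \<alpha>) f g"
    if "\<alpha> \<in> M" for \<alpha> f g
  proof -
    have "omega (pq Q party \<alpha>) (T f) (T g) =
        omega (pq Q party \<alpha>) (u \<alpha> (loc \<alpha> (embed f))) (u \<alpha> (loc \<alpha> (embed g)))"
      using omega_restrict_pauli[of "pq Q party \<alpha>" "T f" "T g"] by (simp add: locT[OF that])
    then show ?thesis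
      by (simp add: isometryD(2)[OF iso[OF that]] omega_embed)
  qed
  moreover have "colocal Q party \<alpha> (T ` S') = T ` colocal Q' party' \<alpha> S'" if a: "\<alpha> \<in> M" for \<alpha>
  proof -
    \<comment> \<open>Injectivity together with \<open>u \<alpha> pzero = pzero\<close>: a local
      component vanishes after \<open>u \<alpha>\<close> exactly when it vanished before.\<close>
    have "u \<alpha> k = pzero \<longleftrightarrow> k = pzero" if "k \<in> Gsp (pq Q party \<alpha>)" for k
      using isometry_bij[OF _ iso[OF a]] isometry_pzero[OF _ iso[OF a]] that finQ
      by (metis Gsp_pzero bij_betw_imp_inj_on finite_pq inj_onD)
    then have "loc \<alpha> (T f) = pzero \<longleftrightarrow> loc \<alpha> (embed f) = pzero" for f
      by (simp add: locT[OF a])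
    then show ?thesis
      unfolding colocal_image_iff[OF injT] loc_embed_eq_pzero[symmetric]
      unfolding restrict_pauli_eq_pzero[symmetric] by simp
  qed
  ultimately show ?thesis by blast
qed

lemma local_extension:
  assumes S': "subspace2 Q' S'"
    and add: "\<And>f g. f \<in> S' \<Longrightarrow> g \<in> S' \<Longrightarrow> T (padd f g) = padd (T f) (T g)"
    and iso: "\<And>f g. f \<in> S' \<Longrightarrow> g \<in> S' \<Longrightarrow>
      omega (pq Q party \<alpha>) (T f) (T g) = omega (pq Q' party' \<alpha>) f g"
    and zero: "\<And>f. f \<in> S' \<Longrightarrow> loc \<alpha> (T f) = pzero \<longleftrightarrow> loc \<alpha> (embed f) = pzero"
  shows "\<exists>U u. implements (pq Q party \<alpha>) U u \<and> (\<forall>f\<in>S'. u (loc \<alpha> (embed f)) = loc \<alpha> (T f))"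
proof -
  define W where "W = (\<lambda>f. loc \<alpha> (embed f)) ` S'"
  \<comment> \<open>An arbitrary preimage of the local component \<open>w\<close> is chosen; fact
    \<open>t\<close> below shows that the value does not depend on it.\<close>
  define t where "t w = loc \<alpha> (T (SOME f. f \<in> S' \<and> loc \<alpha> (embed f) = w))" for w
  have locadd: "loc \<alpha> (embed (padd f g)) = padd (loc \<alpha> (embed f)) (loc \<alpha> (embed g))" for f g
    by (simp add: embed_padd restrict_pauli_padd)
  have t: "t (loc \<alpha> (embed f)) = loc \<alpha> (T f)" if f: "f \<in> S'" for f
  proof -
    define g where "g = (SOME g. g \<in> S' \<and> loc \<alpha> (embed g) = loc \<alpha> (embed f))"
    have g: "g \<in> S' \<and> loc \<alpha> (embed g) = loc \<alpha> (embed f)"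
      unfolding g_def by (rule someI[of _ f]) (use f in simp)
    \<comment> \<open>Equal local components mean that the sum has local component zero, which
      \<open>zero\<close> passes on to \<open>T\<close>.\<close>
    then have "loc \<alpha> (T (padd g f)) = pzero"
      using zero[OF subspace2D(3)[OF S', of g f]] f locadd[of g f] by simp
    then show ?thesis using add[of g f] f g by (simp add: t_def g_def[symmetric] restrict_pauli_padd)
  qed
  have W: "subspace2 (pq Q party \<alpha>) W"
    unfolding subspace2_def
  proof (intro conjI ballI)
    show "W \<subseteq> Gsp (pq Q party \<alpha>)" by (auto simp: W_def)
    show "pzero \<in> W"
      using image_eqI[OF _ subspace2D(2)[OF S'], of pzero "\<lambda>f. loc \<alpha> (embed f)"]
      by (simp add: W_def glue_pzero)
    fix v w assume "v \<in> W" "w \<in> W"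
    then obtain f g where "f \<in> S'" "g \<in> S'" "v = loc \<alpha> (embed f)" "w = loc \<alpha> (embed g)"
      by (auto simp: W_def)
    then show "padd v w \<in> W"
      using subspace2D(3)[OF S'] locadd[of f g] unfolding W_def by (metis imageI)
  qed
  have "\<exists>u\<in>transvections (pq Q party \<alpha>). \<forall>w\<in>W. u w = t w"
  proof (rule witt_extension[OF finite_pq[OF finQ] W, of t])
    show "t \<in> W \<rightarrow> Gsp (pq Q party \<alpha>)" by (auto simp: t_def)
    fix v assume "v \<in> W"
    then obtain f where f: "f \<in> S'" "v = loc \<alpha> (embed f)" by (auto simp: W_def)
    show "v = pzero" if "t v = pzero" using that f t zero by simp
    fix w assume "w \<in> W"
    then obtain g where g: "g \<in> S'" "w = loc \<alpha> (embed g)" by (auto simp: W_def)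
    show "t (padd v w) = padd (t v) (t w)"
      using f g t[OF subspace2D(3)[OF S' f(1) g(1)]]
      by (simp add: t locadd add restrict_pauli_padd)
    show "omega (pq Q party \<alpha>) (t v) (t w) = omega (pq Q party \<alpha>) v w"
      using f g by (simp add: t iso omega_embed)
  qed blast
  then obtain u where u: "u \<in> transvections (pq Q party \<alpha>)" "\<And>w. w \<in> W \<Longrightarrow> u w = t w"
    by blast
  obtain U where "implements (pq Q party \<alpha>) U u"
    using transvections_implemented[OF finite_pq[OF finQ] u(1)] by blast
  moreover have "u (loc \<alpha> (embed f)) = loc \<alpha> (T f)" if "f \<in> S'" for f
    using u(2) t that by (auto simp: W_def)
  ultimately show ?thesis by blast
qed

text \<open>The two sign functions on \<open>S'\<close> differ by a character, which a Pauli operator on the embedded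
  qubits absorbs.\<close>

lemma sign_correction:
  assumes S': "subspace2 Q' S'"
    and \<psi>': "\<exists>x\<in>basis Q'. \<psi>' x \<noteq> 0" and \<Phi>: "\<exists>x\<in>basis Q. \<Phi> x \<noteq> 0"
    and \<epsilon>: "\<And>f. f \<in> S' \<Longrightarrow> \<epsilon> f \<in> {1, -1}" "\<And>f. f \<in> S' \<Longrightarrow> stabilizes Q' f (\<epsilon> f) \<psi>'"
    and \<eta>: "\<And>f. f \<in> S' \<Longrightarrow> \<eta> f \<in> {1, -1}" "\<And>f. f \<in> S' \<Longrightarrow> stabilizes Q (embed f) (\<eta> f) \<Phi>"
  obtains z where "\<And>f. f \<in> S' \<Longrightarrow>
    stabilizes Q (embed f) (\<epsilon> f) (apply_op Q (pauli_op Q (embed z)) \<Phi>)"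
proof -
  have "(\<eta> (padd f g) \<noteq> \<epsilon> (padd f g)) = ((\<eta> f \<noteq> \<epsilon> f) \<noteq> (\<eta> g \<noteq> \<epsilon> g))"
    if fg: "f \<in> S'" "g \<in> S'" for f g
  proof -
    let ?p = "pauli_phase Q' f g"
    have m: "padd f g \<in> S'" using subspace2D(3)[OF S' fg] .
    have "?p * \<epsilon> (padd f g) = \<epsilon> f * \<epsilon> g"
      using stabilizes_padd[OF finQ' \<epsilon>(2)[OF fg(1)] \<epsilon>(2)[OF fg(2)] \<epsilon>(2)[OF m] \<psi>'] .
    moreover have "?p * \<eta> (padd f g) = \<eta> f * \<eta> g"
      using stabilizes_padd[OF finQ \<eta>(2)[OF fg(1)] \<eta>(2)[OF fg(2)] \<eta>(2)[OF m, unfolded embed_padd] \<Phi>]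
      by (simp add: pauli_phase_glue)
    \<comment> \<open>The embedding adds only phase 1 on \<open>R\<close>, so both sign functions
      satisfy the same rule. Dividing removes \<open>?p\<close>, and disagreement of the signs
      becomes an additive function.\<close>
    ultimately show ?thesis
      using \<epsilon>(1)[OF fg(1)] \<epsilon>(1)[OF fg(2)] \<epsilon>(1)[OF m] \<eta>(1)[OF fg(1)] \<eta>(1)[OF fg(2)] \<eta>(1)[OF m]
      by (elim insertE emptyE) simp_all
  qed
  from functional_representable[OF finQ' S', of "\<lambda>f. \<eta> f \<noteq> \<epsilon> f", OF this]
  obtain z where z: "\<And>f. f \<in> S' \<Longrightarrow> omega Q' z f = (\<eta> f \<noteq> \<epsilon> f)" by metis
  have "stabilizes Q (embed f) (\<epsilon> f) (apply_op Q (pauli_op Q (embed z)) \<Phi>)" if f: "f \<in> S'" for f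
  proof -
    let ?t = "omega_sign Q (embed z) (embed f)"
    have t: "?t = (if \<eta> f \<noteq> \<epsilon> f then -1 else 1)"
      using z[OF f] finQ by (simp add: omega_sign_eq omega_glue_all)
    have "stabilizes Q (embed f) (\<eta> f * ?t) (apply_op Q (pauli_op Q (embed z)) \<Phi>)"
      using t pauli_commute[OF finQ, of "embed z" "embed f"]
      by (intro stabilizes_intertwine[OF _ _ \<eta>(2)[OF f]]) simp_all
    moreover have "\<eta> f * ?t = \<epsilon> f" using \<epsilon>(1)[OF f] \<eta>(1)[OF f] t by auto
    ultimately show ?thesis by simp
  qed
  then show ?thesis by (rule that)
qed

text \<open>The equality obtained is exact, with no leftover phase, because the product state is
  obtained from \<psi> itself by invertible operators.\<close>

lemma backward:
  assumes \<psi>: "stabilizer_state Q S \<psi>" and \<psi>': "stabilizer_state Q' S' \<psi>'"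
    and T: "\<And>f. f \<in> S' \<Longrightarrow> T f \<in> S"
    and add: "\<And>f g. f \<in> S' \<Longrightarrow> g \<in> S' \<Longrightarrow> T (padd f g) = padd (T f) (T g)"
    and iso: "\<And>\<alpha> f g. \<alpha> \<in> M \<Longrightarrow> f \<in> S' \<Longrightarrow> g \<in> S' \<Longrightarrow>
      omega (pq Q party \<alpha>) (T f) (T g) = omega (pq Q' party' \<alpha>) f g"
    and zero: "\<And>\<alpha> f. \<alpha> \<in> M \<Longrightarrow> f \<in> S' \<Longrightarrow> loc \<alpha> (T f) = pzero \<longleftrightarrow> loc \<alpha> (embed f) = pzero"
  shows "\<exists>S'' \<psi>''. stabilizer_state R S'' \<psi>'' \<and>
    (\<exists>U. (\<forall>\<alpha>\<in>M. clifford (pq Q party \<alpha>) (U \<alpha>)) \<and>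
      st_eq Q \<psi> (apply_op Q (tensor_local M Q party U)
        (\<lambda>x. \<psi>' (pull x) * \<psi>'' (restrict_bits R x))))"
proof -
  note S' = self_dualD(1)[OF stabilizer_stateD(1)[OF \<psi>']]
  have "\<forall>\<alpha>\<in>M. \<exists>U u. implements (pq Q party \<alpha>) U u \<and>
      (\<forall>f\<in>S'. u (loc \<alpha> (embed f)) = loc \<alpha> (T f))"
    using local_extension[OF S' add iso zero] by blast
  then obtain U u where u: "\<And>\<alpha>. \<alpha> \<in> M \<Longrightarrow> implements (pq Q party \<alpha>) (U \<alpha>) (u \<alpha>)"
    "\<And>\<alpha> f. \<alpha> \<in> M \<Longrightarrow> f \<in> S' \<Longrightarrow> u \<alpha> (loc \<alpha> (embed f)) = loc \<alpha> (T f)"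
    by metis
  let ?V = "tensor_local M Q party U" and ?u = "local_map Q party u"
  have V: "implements Q ?V ?u" using u(1) by (rule implements_tensor)
  note unV = implementsD(1)[OF V] and isoV = implements_isometry[OF finQ V]
  \<comment> \<open>The agreements at the single parties assemble to one on all qubits, since every
    qubit belongs to a party in \<open>M\<close>.\<close>
  have uT: "?u (embed f) = T f" if f: "f \<in> S'" for f
  proof (rule Gsp_eq_parties)
    show "T f \<in> Gsp Q" using self_dualD(2)[OF stabilizer_stateD(1)[OF \<psi>] T[OF f]] .
    fix \<alpha> assume a: "\<alpha> \<in> M"
    show "loc \<alpha> (?u (embed f)) = loc \<alpha> (T f)"
      using implementsD(2)[OF u(1)[OF a]] u(2)[OF a f] by (subst restrict_local_map) auto
  qed simp
  \<comment> \<open>What \<open>S\<close> becomes when the local Cliffords are undone: the group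
    stabilizing \<open>\<Phi>0\<close> up to signs.\<close>
  define W where "W = {h \<in> Gsp Q. ?u h \<in> S}"
  have W: "self_dual Q W"
    unfolding W_def by (rule self_dual_vimage[OF finQ isoV stabilizer_stateD(1)[OF \<psi>]])
  define \<Phi>0 where "\<Phi>0 = apply_op Q (adj ?V) \<psi>"
  have stab0: "\<exists>s\<in>{1, -1}. stabilizes Q h s \<Phi>0" if h: "h \<in> W" for h
  proof -
    have "?u h \<in> S" using h by (simp add: W_def)
    then obtain r where r: "r \<in> {1, -1}" "stabilizes Q (?u h) r \<psi>"
      using stabilizer_stateE[OF \<psi>] by metis
    obtain t where t: "t \<in> {1, -1}" "op_eq Q (mmul Q (adj ?V) (pauli_op Q (?u h)))
        (\<lambda>y x. t * mmul Q (pauli_op Q h) (adj ?V) y x)"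
      using implements_adj[OF finQ V, of h] h unfolding W_def by blast
    have "r * t \<in> {1, -1}" using r(1) t(1) by auto
    then show ?thesis
      unfolding \<Phi>0_def using stabilizes_intertwine[OF t(2,1) r(2)] by blast
  qed
  have inner0: "inner Q \<Phi>0 \<Phi>0 = 1"
    unfolding \<Phi>0_def inner_unitary[OF finQ unitary_on_adj[OF unV]] by (rule stabilizer_stateD(2)[OF \<psi>])
  then have nz0: "\<exists>x\<in>basis Q. \<Phi>0 x \<noteq> 0"
    by (auto simp: inner_def intro: ccontr)
  have embedW: "embed f \<in> W" if "f \<in> S'" for f
    using T[OF that] by (simp add: W_def uT[OF that])
  obtain \<eta> where \<eta>: "\<And>f. f \<in> S' \<Longrightarrow> \<eta> f \<in> {1, -1}" "\<And>f. f \<in> S' \<Longrightarrow> stabilizes Q (embed f) (\<eta> f) \<Phi>0"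
    using stab0[OF embedW] by metis
  obtain \<epsilon> where \<epsilon>: "\<And>f. f \<in> S' \<Longrightarrow> \<epsilon> f \<in> {1, -1}" "\<And>f. f \<in> S' \<Longrightarrow> stabilizes Q' f (\<epsilon> f) \<psi>'"
    using stabilizer_stateE[OF \<psi>'] by metis
  obtain z where z: "\<And>f. f \<in> S' \<Longrightarrow>
      stabilizes Q (embed f) (\<epsilon> f) (apply_op Q (pauli_op Q (embed z)) \<Phi>0)"
    using sign_correction[OF S' stabilizer_stateD(3)[OF \<psi>'] nz0 \<epsilon> \<eta>] by blast
  let ?P = "pauli_op Q (embed z)"
  define \<Phi> where "\<Phi> = apply_op Q ?P \<Phi>0"
  \<comment> \<open>A Pauli operator implements \<open>id\<close>, so the group \<open>W\<close>
    persists and only the signs move.\<close>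
  have stab: "\<exists>s\<in>{1, -1}. stabilizes Q h s \<Phi>" if h: "h \<in> W" for h
    using stab0[OF h] stabilizes_implements[OF implements_pauli[OF finQ]] h
    unfolding \<Phi>_def W_def by (metis (no_types, lifting) id_apply mem_Collect_eq)
  obtain \<psi>'' where \<psi>'': "\<And>z. z \<notin> basis R \<Longrightarrow> \<psi>'' z = 0"
    "\<And>y z. y \<in> basis Q' \<Longrightarrow> z \<in> basis R \<Longrightarrow> \<Phi> (glue e Q' y z) = \<psi>' y * \<psi>'' z"
    using factorization[OF \<psi>' \<epsilon> z[folded \<Phi>_def]] by blast
  have "inner Q \<Phi> \<Phi> = 1"
    unfolding \<Phi>_def using inner_unitary[OF finQ pauli_unitary[OF finQ]] inner0 by simp
  then have inner'': "inner R \<psi>'' \<psi>'' = 1"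
    using inner_product_state[of \<Phi> \<psi>' \<psi>'', OF \<psi>''(2)] stabilizer_stateD(2)[OF \<psi>'] by simp
  have "stabilizer_state R {h \<in> Gsp R. glue e Q' pzero h \<in> W} \<psi>''"
  proof (rule stabilizer_stateI)
    show "self_dual R {h \<in> Gsp R. glue e Q' pzero h \<in> W}"
      using self_dual_complement[OF stabilizer_stateD(1)[OF \<psi>'] W embedW] .
    fix h assume "h \<in> {h \<in> Gsp R. glue e Q' pzero h \<in> W}"
    then show "\<exists>s\<in>{1, -1}. stabilizes R h s \<psi>''"
      using stab stabilizes_right_factor[of \<Phi> \<psi>' \<psi>'', OF \<psi>''(2) _ stabilizer_stateD(3)[OF \<psi>']]
      by blast
  qed (use \<psi>''(1) inner'' in auto)
  \<comment> \<open>A Pauli operator is a tensor product over the parties, so each local Clifford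
    can absorb its own component of the sign correction.\<close>
  moreover define U' where
    "U' \<alpha> = mmul (pq Q party \<alpha>) (U \<alpha>) (pauli_op (pq Q party \<alpha>) (loc \<alpha> (embed z)))" for \<alpha>
  moreover have "clifford (pq Q party \<alpha>) (U' \<alpha>)" if "\<alpha> \<in> M" for \<alpha>
    using implements_mmul[OF _ u(1)[OF that] implements_pauli] finQ
    by (auto simp: U'_def clifford_iff_implements)
  moreover have "st_eq Q \<psi> (apply_op Q (tensor_local M Q party U')
      (\<lambda>x. \<psi>' (pull x) * \<psi>'' (restrict_bits R x)))"
  proof -
    have prod: "st_eq Q (\<lambda>x. \<psi>' (pull x) * \<psi>'' (restrict_bits R x)) \<Phi>"
      using \<psi>''(2) by (intro st_eq_glueI) simp
    have "tensor_local M Q party U' = mmul Q ?V ?P"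
      unfolding U'_def pauli_op_tensor[of "embed z"] mmul_tensor ..
    \<comment> \<open>Undoing the construction: \<open>?P\<close> squares to the identity, which
      recovers \<open>\<Phi>0\<close>, and then \<open>?V\<close> cancels its adjoint.\<close>
    then have "apply_op Q (tensor_local M Q party U') (\<lambda>x. \<psi>' (pull x) * \<psi>'' (restrict_bits R x)) =
        apply_op Q ?V (apply_op Q (mmul Q ?P ?P) \<Phi>0)"
      using apply_cong_state[OF prod] by (simp add: apply_mmul \<Phi>_def)
    also have "\<dots> = apply_op Q ?V \<Phi>0"
      by (rule apply_cong_state[OF apply_id[OF finQ pauli_square[OF finQ]]])
    also have "\<dots> = apply_op Q (mmul Q ?V (adj ?V)) \<psi>"
      by (simp add: apply_mmul \<Phi>0_def)
    finally show ?thesis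
      using st_eq_sym[OF apply_id[OF finQ, of "mmul Q ?V (adj ?V)"]] unV by (simp add: unitary_on_def)
  qed
  ultimately show ?thesis by blast
qed

end

text \<open>Injections chosen party by party combine, since images belonging to different parties
  are disjoint.\<close>

lemma party_preserving_injection:
  fixes party :: "'p \<Rightarrow> 'm" and party' :: "'q \<Rightarrow> 'm"
  assumes "finite Q" "finite Q'" "party' ` Q' \<subseteq> M"
    and le: "\<forall>\<alpha>\<in>M. card (pq Q' party' \<alpha>) \<le> card (pq Q party \<alpha>)"
  obtains e where "inj_on e Q'" "e ` Q' \<subseteq> Q" "\<And>q. q \<in> Q' \<Longrightarrow> party (e q) = party' q"
proof -
  have "\<forall>\<alpha>\<in>M. \<exists>e. inj_on e (pq Q' party' \<alpha>) \<and> e ` pq Q' party' \<alpha> \<subseteq> pq Q party \<alpha>"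
    using le assms(1,2) card_le_inj[OF finite_pq finite_pq] by metis
  then obtain E where E: "\<And>\<alpha>. \<alpha> \<in> M \<Longrightarrow> inj_on (E \<alpha>) (pq Q' party' \<alpha>)"
    "\<And>\<alpha>. \<alpha> \<in> M \<Longrightarrow> E \<alpha> ` pq Q' party' \<alpha> \<subseteq> pq Q party \<alpha>" by metis
  define e where "e q = E (party' q) q" for q
  have e: "e q \<in> Q \<and> party (e q) = party' q" if "q \<in> Q'" for q
    using E(2)[of "party' q"] assms(3) that by (auto simp: e_def pq_def image_subset_iff)
  have "inj_on e Q'"
  proof (rule inj_onI)
    fix q r assume qr: "q \<in> Q'" "r \<in> Q'" "e q = e r"
    then have "party' q = party' r" using e by metis
    then show "q = r"
      using E(1)[of "party' q"] qr assms(3) by (auto simp: e_def inj_on_def pq_def)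
  qed
  with e show ?thesis using that by blast
qed

theorem theorem2:
  fixes M :: "'m set"
    and Q :: "'p set" and party :: "'p \<Rightarrow> 'm" and S :: "'p pauli set" and \<psi> :: "'p state"
    and Q' :: "'q set" and party' :: "'q \<Rightarrow> 'm" and S' :: "'q pauli set" and \<psi>' :: "'q state"
  assumes "finite M" and "finite Q" and "finite Q'"
    and "party ` Q \<subseteq> M" and "party' ` Q' \<subseteq> M"
    and "\<forall>\<alpha>\<in>M. card (pq Q' party' \<alpha>) \<le> card (pq Q party \<alpha>)"
    and "stabilizer_state Q S \<psi>"
    and "stabilizer_state Q' S' \<psi>'"
  shows "extractable M Q' party' \<psi>' Q party \<psi> \<longleftrightarrow>
    (\<exists>T :: 'q pauli \<Rightarrow> 'p pauli.
       (\<forall>f\<in>S'. T f \<in> S) \<and> (\<forall>f\<in>S'. \<forall>g\<in>S'. T (padd f g) = padd (T f) (T g)) \<and> inj_on T S' \<and>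
       (\<forall>f\<in>S'. \<forall>g\<in>S'. \<forall>\<alpha>\<in>M.
          omega (pq Q party \<alpha>) (T f) (T g) = omega (pq Q' party' \<alpha>) f g) \<and>
       (\<forall>\<alpha>\<in>M. colocal Q party \<alpha> (T ` S') = T ` (colocal Q' party' \<alpha> S')))"
    (is "_ \<longleftrightarrow> ?T")
proof
  assume "extractable M Q' party' \<psi>' Q party \<psi>"
  then show ?T
    unfolding extractable_def
  proof (elim exE conjE)
    fix e S'' \<psi>'' U c
    assume "inj_on e Q'" "e ` Q' \<subseteq> Q" "\<forall>q\<in>Q'. party (e q) = party' q"
    then interpret party_embedding M Q party e Q' party'
      by unfold_locales (use assms in auto)
    assume "\<forall>\<alpha>\<in>M. clifford (pq Q party \<alpha>) (U \<alpha>)"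
      and "st_eq Q \<psi> (\<lambda>y. c * apply_op Q (tensor_local M Q party U)
        (\<lambda>x. \<psi>' (pull x) * \<psi>'' (restrict_bits R x)) y)"
    then show ?T using forward[OF assms(7,8)] by blast
  qed
next
  assume ?T
  then obtain T where T: "\<forall>f\<in>S'. T f \<in> S"
    "\<forall>f\<in>S'. \<forall>g\<in>S'. T (padd f g) = padd (T f) (T g)"
    and injT: "inj_on T S'"
    and iso: "\<forall>f\<in>S'. \<forall>g\<in>S'. \<forall>\<alpha>\<in>M.
      omega (pq Q party \<alpha>) (T f) (T g) = omega (pq Q' party' \<alpha>) f g"
    and col: "\<forall>\<alpha>\<in>M. colocal Q party \<alpha> (T ` S') = T ` colocal Q' party' \<alpha> S'"
    by (elim exE conjE) (rule that)
  \<comment> \<open>Any placement within the parties will do: the local isometries obtained from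
    Witt's theorem are built relative to the chosen \<open>e\<close>.\<close>
  obtain e where e: "inj_on e Q'" "e ` Q' \<subseteq> Q" "\<And>q. q \<in> Q' \<Longrightarrow> party (e q) = party' q"
    using party_preserving_injection[OF assms(2,3,5,6)] by blast
  interpret party_embedding M Q party e Q' party'
    by unfold_locales (use assms e in auto)
  have "loc \<alpha> (T f) = pzero \<longleftrightarrow> loc \<alpha> (embed f) = pzero" if "\<alpha> \<in> M" "f \<in> S'" for \<alpha> f
    using bspec[OF col that(1)] that(2)
    unfolding colocal_image_iff[OF injT] restrict_pauli_eq_pzero[of _ "T f"] loc_embed_eq_pzero
    by blast
  with backward[OF assms(7,8), of T] T iso
  obtain S'' \<psi>'' U where *: "stabilizer_state (Q - e ` Q') S'' \<psi>''"
    "\<forall>\<alpha>\<in>M. clifford (pq Q party \<alpha>) (U \<alpha>)"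
    "st_eq Q \<psi> (apply_op Q (tensor_local M Q party U)
        (\<lambda>x. \<psi>' (\<lambda>q. q \<in> Q' \<and> x (e q)) * \<psi>'' (restrict_bits (Q - e ` Q') x)))"
    by blast
  show "extractable M Q' party' \<psi>' Q party \<psi>"
    unfolding extractable_def
    by (intro exI[of _ e] conjI exI[of _ S''] exI[of _ \<psi>''] exI[of _ U] exI[of _ 1])
      (use e * in auto)
qed

end
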